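(* Let $(v_n)_{n\ge1}$ be a sequence of positive real numbers such that $\lim_{n\to+\infty}\frac{v_n}{n}=0$. Then there exists a homeomorphism $f$ in $\mathrm{Homeo}_0(\mathbb R/\mathbb Z\times[0,1],\ \mathbb R/\mathbb Z\times\{0,1\})$ such that: 1. for all $n\ge1$, $\ \delta(\tilde f^{\,n}([0,1]\times[0,1]))\ge v_n$; 2. the homeomorphism $f$ is a distortion element in $\mathrm{Homeo}_0(\mathbb R/\mathbb Z\times[0,1],\ \mathbb R/\mathbb Z\times\{0,1\})$.
   Context: $\mathrm{Homeo}_0(\mathbb R/\mathbb Z\times[0,1],\mathbb R/\mathbb Z\times\{0,1\})$ is the identity component of the group of homeomorphisms of the closed annulus which pointwise fix a neighbourhood of its boundary. For $f$ in this group, $\tilde f:\mathbb R\times[0,1]\to\mathbb R\times[0,1]$ is the lift of $f$ to the universal cover obtained as the time $1$ of the lift, starting at the identity, of an isotopy from the identity to $f$ relative to the boundary. $\delta(A)$ is the Euclidean diameter of $A\subset\mathbb R^2$. Distortion. If $G$ is generated by a finite set $\mathcal G$, $l_{\mathcal G}(g)$ is the minimal length of a word in elements of $\mathcal G$ and their inverses representing $g$; $g$ is distorted in $G$ if $\lim_{n\to\infty} l_{\mathcal G}(g^n)/n=0$. In a general group $G$, $g$ is a distortion element if it belongs to a finitely generated subgroup of $G$ in which it is distorted. *)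

theory Defs
  imports "HOL-Analysis.Analysis" "HOL-Algebra.Bij" "HOL-Algebra.Generated_Groups"
begin

section \<open>Distortion in groups\<close>

definition word_length :: "('a, 'b) monoid_scheme \<Rightarrow> 'a set \<Rightarrow> 'a \<Rightarrow> nat" where
  "word_length G S g =
     (LEAST n. \<exists>w. set w \<subseteq> S \<union> m_inv G ` S \<and> length w = n \<and> foldr (mult G) w \<one>\<^bsub>G\<^esub> = g)"

text \<open>
  The condition does not depend on the choice of the finite generating set: two word lengths
  differ at most by a multiplicative constant.
\<close>
definition distorted :: "('a, 'b) monoid_scheme \<Rightarrow> 'a \<Rightarrow> bool" where
  "distorted G g \<longleftrightarrow> g \<in> carrier G \<and>
     (\<exists>S. finite S \<and> S \<subseteq> carrier G \<and> generate G S = carrier G \<and>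
        (\<lambda>n::nat. real (word_length G S (g [^]\<^bsub>G\<^esub> n)) / real n) \<longlonglongrightarrow> 0)"

definition distortion_element :: "('a, 'b) monoid_scheme \<Rightarrow> 'a \<Rightarrow> bool" where
  "distortion_element G g \<longleftrightarrow> (\<exists>H. subgroup H G \<and> g \<in> H \<and> distorted (G\<lparr>carrier := H\<rparr>) g)"


section \<open>The closed annulus and its homeomorphisms\<close>

text \<open>
  The circle \<open>\<real>/\<int>\<close> is realised as the unit circle of the complex plane, the class of a real
  number \<open>x\<close> being the point \<open>exp (2 \<pi> i x)\<close>.
\<close>
definition annulus :: "(complex \<times> real) set" where
  "annulus = sphere 0 1 \<times> {0..1}"

definition annulus_boundary :: "(complex \<times> real) set" where
  "annulus_boundary = sphere 0 1 \<times> {0, 1}"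

definition strip :: "(real \<times> real) set" where
  "strip = UNIV \<times> {0..1}"

definition annulus_cover :: "real \<times> real \<Rightarrow> complex \<times> real" where
  "annulus_cover = (\<lambda>(x, y). (cis (2 * pi * x), y))"

text \<open>
  Homeomorphisms of the annulus are represented, as in \<^const>\<open>BijGroup\<close>, by functions that are
  \<^const>\<open>undefined\<close> outside of the annulus.
\<close>
definition annulus_homeos :: "(complex \<times> real \<Rightarrow> complex \<times> real) set" where
  "annulus_homeos = {f \<in> Bij annulus.
     homeomorphic_map (top_of_set annulus) (top_of_set annulus) f \<and>
     (\<exists>U. openin (top_of_set annulus) U \<and> annulus_boundary \<subseteq> U \<and> (\<forall>z\<in>U. f z = z))}"

text \<open>The topology of uniform convergence (equivalently, the compact-open topology).\<close>
definition annulus_homeos_topology :: "(complex \<times> real \<Rightarrow> complex \<times> real) topology" where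
  "annulus_homeos_topology =
     subtopology (mtopology_of (cfunspace (top_of_set annulus) euclidean_metric)) annulus_homeos"

definition Homeo0_annulus :: "(complex \<times> real \<Rightarrow> complex \<times> real) monoid" where
  "Homeo0_annulus = (BijGroup annulus)
     \<lparr>carrier := connected_component_of_set annulus_homeos_topology (\<lambda>z\<in>annulus. z)\<rparr>"


section \<open>The lift to the universal cover\<close>

definition isotopy_rel_boundary ::
    "(real \<times> (complex \<times> real) \<Rightarrow> complex \<times> real) \<Rightarrow> (complex \<times> real \<Rightarrow> complex \<times> real) \<Rightarrow> bool" where
  "isotopy_rel_boundary h f \<longleftrightarrow>
     continuous_on ({0..1} \<times> annulus) h \<and>
     (\<forall>t\<in>{0..1}. homeomorphic_map (top_of_set annulus) (top_of_set annulus) (\<lambda>z. h (t, z))) \<and>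
     (\<forall>t\<in>{0..1}. \<forall>z\<in>annulus_boundary. h (t, z) = z) \<and>
     (\<forall>z\<in>annulus. h (0, z) = z) \<and>
     (\<forall>z\<in>annulus. h (1, z) = f z)"

definition lifts_isotopy ::
    "(real \<times> (real \<times> real) \<Rightarrow> real \<times> real) \<Rightarrow> (real \<times> (complex \<times> real) \<Rightarrow> complex \<times> real) \<Rightarrow> bool" where
  "lifts_isotopy H h \<longleftrightarrow>
     continuous_on ({0..1} \<times> strip) H \<and>
     (\<forall>t\<in>{0..1}. \<forall>p\<in>strip. H (t, p) \<in> strip) \<and>
     (\<forall>t\<in>{0..1}. \<forall>p\<in>strip. annulus_cover (H (t, p)) = h (t, annulus_cover p)) \<and>
     (\<forall>p\<in>strip. H (0, p) = p)"

text \<open>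
  \<open>is_isotopy_lift f F\<close> says that \<open>F\<close> is, on the strip, the lift of \<open>f\<close> given by the time 1 of the
  lift starting at the identity of an isotopy from the identity to \<open>f\<close>. The values of \<open>F\<close> outside
  of the strip are irrelevant. That \<open>F\<close> is determined by \<open>f\<close> on the strip, whatever the isotopy,
  is proved below.
\<close>
definition is_isotopy_lift ::
    "(complex \<times> real \<Rightarrow> complex \<times> real) \<Rightarrow> (real \<times> real \<Rightarrow> real \<times> real) \<Rightarrow> bool" where
  "is_isotopy_lift f F \<longleftrightarrow>
     (\<exists>h H. isotopy_rel_boundary h f \<and> lifts_isotopy H h \<and> (\<forall>p\<in>strip. F p = H (1, p)))"

lemma annulus_cover_eqD:
  assumes "annulus_cover p = annulus_cover q"
  shows "fst p - fst q \<in> \<int>" "snd p = snd q"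
proof -
  have "cis (2 * pi * fst p) = cis (2 * pi * fst q)" and s: "snd p = snd q"
    using assms by (auto simp: annulus_cover_def split: prod.splits)
  then have "cis (2 * pi * fst p - 2 * pi * fst q) = 1"
    by (simp flip: cis_divide)
  then have "cos (2 * pi * fst p - 2 * pi * fst q) = 1"
    by (metis cis.simps(1) one_complex.simps(1))
  then obtain n :: int where "2 * pi * fst p - 2 * pi * fst q = of_int n * 2 * pi"
    by (auto simp: cos_one_2pi_int)
  then have "2 * pi * (fst p - fst q) = 2 * pi * of_int n"
    by (simp add: algebra_simps)
  then have "fst p - fst q = of_int n"
    by simp
  then show "fst p - fst q \<in> \<int>" by simp
  show "snd p = snd q" by (fact s)
qed

lemma continuous_Ints_eq:
  fixes g :: "'a::topological_space \<Rightarrow> real"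
  assumes "connected S" "continuous_on S g" "\<And>x. x \<in> S \<Longrightarrow> g x \<in> \<int>" "x \<in> S" "y \<in> S"
  shows "g x = g y"
proof -
  have "g constant_on S"
  proof (rule continuous_discrete_range_constant[OF assms(1,2)])
    fix x assume "x \<in> S"
    then have "1 \<le> norm (g y - g x)" if "y \<in> S" "g y \<noteq> g x" for y
      using that assms(3) Ints_nonzero_abs_ge1[of "g y - g x"] by auto
    then show "\<exists>e>0. \<forall>y. y \<in> S \<and> g y \<noteq> g x \<longrightarrow> e \<le> norm (g y - g x)"
      using zero_less_one by blast
  qed
  then show ?thesis
    using assms(4,5) by (auto simp: constant_on_def)
qed

lemma is_isotopy_lift_continuous:
  assumes "is_isotopy_lift f F"
  shows "continuous_on strip F" "\<And>p. p \<in> strip \<Longrightarrow> annulus_cover (F p) = f (annulus_cover p)"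
    "F (0, 0) = (0, 0)"
proof -
  obtain h H where h: "isotopy_rel_boundary h f" and H: "lifts_isotopy H h"
    and F: "\<And>p. p \<in> strip \<Longrightarrow> F p = H (1, p)"
    using assms unfolding is_isotopy_lift_def by blast
  have cH: "continuous_on ({0..1} \<times> strip) H"
    using H by (simp add: lifts_isotopy_def)
  have "continuous_on strip (\<lambda>p. H (1, p))"
    by (rule continuous_on_compose2[OF cH]) (auto intro!: continuous_intros)
  then show "continuous_on strip F"
    using F by (simp cong: continuous_on_cong)
  show "annulus_cover (F p) = f (annulus_cover p)" if "p \<in> strip" for p
  proof -
    have "annulus_cover p \<in> annulus"
      using that by (auto simp: annulus_cover_def annulus_def strip_def)
    then show ?thesis
      using that h H F by (simp add: isotopy_rel_boundary_def lifts_isotopy_def)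
  qed
  have z: "(0, 0) \<in> strip" "annulus_cover (0, 0) \<in> annulus_boundary"
    by (auto simp: strip_def annulus_cover_def annulus_boundary_def)
  have c: "annulus_cover (H (t, (0, 0))) = annulus_cover (0, 0)" if "t \<in> {0..1}" for t
    using h H z that by (auto simp: isotopy_rel_boundary_def lifts_isotopy_def)
  have "continuous_on {0..1} (\<lambda>t. fst (H (t, (0, 0))))"
    using z(1) by (intro continuous_on_fst continuous_on_compose2[OF cH]) (auto intro!: continuous_intros)
  then have "fst (H (1, (0, 0))) = fst (H (0, (0, 0)))"
    using annulus_cover_eqD(1)[OF c] by (intro continuous_Ints_eq[of "{0..1::real}"]) auto
  moreover have "H (0, (0, 0)) = (0, 0)"
    using H z by (auto simp: lifts_isotopy_def)
  moreover have "snd (H (1, (0, 0))) = 0"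
    using annulus_cover_eqD(2)[OF c, of 1] by simp
  ultimately show "F (0, 0) = (0, 0)"
    using F[OF z(1)] by (simp add: prod_eq_iff)
qed

lemma is_isotopy_lift_unique:
  assumes F: "is_isotopy_lift f F" and G: "is_isotopy_lift f G" and p: "p \<in> strip"
  shows "F p = G p"
proof -
  have c: "annulus_cover (F q) = annulus_cover (G q)" if "q \<in> strip" for q
    using that is_isotopy_lift_continuous(2)[OF F] is_isotopy_lift_continuous(2)[OF G] by simp
  have "connected strip"
    unfolding strip_def by (intro connected_Times) auto
  moreover have "continuous_on strip (\<lambda>q. fst (F q) - fst (G q))"
    using is_isotopy_lift_continuous(1)[OF F] is_isotopy_lift_continuous(1)[OF G]
    by (intro continuous_intros)
  moreover have "(0, 0) \<in> strip" by (simp add: strip_def)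
  ultimately have "fst (F p) - fst (G p) = fst (F (0, 0)) - fst (G (0, 0))"
    using annulus_cover_eqD(1)[OF c] p by (intro continuous_Ints_eq[of strip]) auto
  then show ?thesis
    using annulus_cover_eqD(2)[OF c[OF p]] is_isotopy_lift_continuous(3)[OF F]
      is_isotopy_lift_continuous(3)[OF G] by (simp add: prod_eq_iff)
qed

end

theory Submission
  imports Defs "HOL-Real_Asymp.Real_Asymp"
begin

text \<open>
  All maps are skew products \<open>(x, y) \<mapsto> (x + \<theta> y, g y)\<close>. Take \<open>f = (x + \<phi> y, g y)\<close> where \<open>g\<close> pushes
  an interval upwards and \<open>\<phi>\<close> tends to 0 at its ends. Then \<open>f ^ n\<close> is the composition of the twist
  by the Birkhoff sum \<open>S n = \<Sum>i<n. \<phi> \<circ> g ^ i\<close> with \<open>g ^ n\<close>. As \<open>\<phi>\<close> may decay arbitrarily slowly along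
  an orbit, \<open>S n\<close> can be made to exceed \<open>v n\<close> there, but it is always uniformly \<open>o(n)\<close>.

  For the distortion, \<open>g\<close> is conjugate to \<open>g ^ 2\<close>, so \<open>g ^ 2 ^ m\<close> has length \<open>O(m)\<close>. Moreover, all twists
  by a sequence \<open>\<eta> k\<close> with \<open>\<bar>\<eta> k\<bar> \<le> 1 / 2 ^ k\<close> can be written with \<open>O(k)\<close> letters of a finite set:
  one twist \<open>\<Theta>\<close> stores the whole sequence on disjoint intervals. Applied to \<open>\<eta> k = S n / Q\<close> for a
  sparse sequence of \<open>n = 2 ^ m k\<close> and \<open>Q = Q k\<close> slightly larger than \<open>2 ^ k * sup \<bar>S n\<bar>\<close>, this writes
  the twist by \<open>S n\<close> as the \<open>Q\<close>-th power of a word of length \<open>O(k)\<close>, which makes the length of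
  \<open>f ^ n\<close> small compared to \<open>n\<close>.
\<close>


section \<open>Words in a finitely generated group\<close>

text \<open>An upper bound \<open>n\<close> in place of the exact minimum: such bounds add up under
  products and survive inverses, so no shortest word has to be found.\<close>

definition word_in :: "('a, 'b) monoid_scheme \<Rightarrow> 'a set \<Rightarrow> nat \<Rightarrow> 'a \<Rightarrow> bool" where
  "word_in G S n g \<longleftrightarrow>
     (\<exists>w. set w \<subseteq> S \<union> m_inv G ` S \<and> length w \<le> n \<and> foldr (mult G) w \<one>\<^bsub>G\<^esub> = g)"

lemma word_length_le: "word_in G S n g \<Longrightarrow> word_length G S g \<le> n"
  unfolding word_in_def word_length_def by (elim exE conjE) (rule order_trans[OF Least_le], blast)

context group
begin

lemma foldr_mult_append:
  assumes "set v \<subseteq> carrier G" "set w \<subseteq> carrier G"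
  shows "foldr (\<otimes>) v \<one> \<in> carrier G"
    and "foldr (\<otimes>) (v @ w) \<one> = foldr (\<otimes>) v \<one> \<otimes> foldr (\<otimes>) w \<one>"
proof -
  have c: "foldr (\<otimes>) u \<one> \<in> carrier G" if "set u \<subseteq> carrier G" for u
    using that by (induction u) auto
  show "foldr (\<otimes>) v \<one> \<in> carrier G" by (rule c) fact
  show "foldr (\<otimes>) (v @ w) \<one> = foldr (\<otimes>) v \<one> \<otimes> foldr (\<otimes>) w \<one>"
    using assms by (induction v) (auto simp: c m_assoc)
qed

lemma gens_carrier: "S \<subseteq> carrier G \<Longrightarrow> S \<union> m_inv G ` S \<subseteq> carrier G"
  by auto

lemma word_in_gen: "S \<subseteq> carrier G \<Longrightarrow> g \<in> S \<Longrightarrow> word_in G S 1 g"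
  unfolding word_in_def by (rule exI[of _ "[g]"]) auto

lemma word_in_one: "word_in G S 0 \<one>"
  unfolding word_in_def by (rule exI[of _ "[]"]) auto

lemma word_in_mult:
  assumes S: "S \<subseteq> carrier G" and "word_in G S m g" "word_in G S n h"
  shows "word_in G S (m + n) (g \<otimes> h)"
proof -
  obtain v w where "set v \<subseteq> S \<union> m_inv G ` S" "length v \<le> m" "foldr (\<otimes>) v \<one> = g"
    and "set w \<subseteq> S \<union> m_inv G ` S" "length w \<le> n" "foldr (\<otimes>) w \<one> = h"
    using assms(2,3) unfolding word_in_def by blast
  moreover from this have "foldr (\<otimes>) (v @ w) \<one> = g \<otimes> h"
    using foldr_mult_append(2)[of v w] gens_carrier[OF S] by blast
  ultimately show ?thesis
    unfolding word_in_def by (intro exI[of _ "v @ w"]) simp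
qed

lemma word_in_inv:
  assumes S: "S \<subseteq> carrier G" and "word_in G S n g"
  shows "word_in G S n (inv g)"
proof -
  have "\<exists>v. set v \<subseteq> S \<union> m_inv G ` S \<and> length v = length w \<and> foldr (\<otimes>) v \<one> = inv (foldr (\<otimes>) w \<one>)"
    if "set w \<subseteq> S \<union> m_inv G ` S" for w
    using that
  proof (induction w)
    case Nil
    then show ?case by simp
  next
    case (Cons a w)
    then obtain v where v: "set v \<subseteq> S \<union> m_inv G ` S" "length v = length w"
      "foldr (\<otimes>) v \<one> = inv (foldr (\<otimes>) w \<one>)"
      by auto
    have a: "a \<in> carrier G" "set w \<subseteq> carrier G" "set v \<subseteq> carrier G"
      using Cons.prems v(1) gens_carrier[OF S] by auto
    have "inv a \<in> S \<union> m_inv G ` S"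
      using Cons.prems S by auto
    moreover have "foldr (\<otimes>) (v @ [inv a]) \<one> = inv (foldr (\<otimes>) (a # w) \<one>)"
      using a v(3) foldr_mult_append[of v "[inv a]"] foldr_mult_append(1)[of w w]
      by (simp add: inv_mult_group)
    ultimately show ?case
      using v by (intro exI[of _ "v @ [inv a]"]) auto
  qed
  then show ?thesis
    using assms(2) unfolding word_in_def by metis
qed

lemma word_in_conj:
  assumes S: "S \<subseteq> carrier G" and "word_in G S m h" "word_in G S n x"
  shows "word_in G S (2 * m + n) (inv h \<otimes> (x \<otimes> h))"
  using word_in_mult[OF S word_in_inv[OF S assms(2)] word_in_mult[OF S assms(3,2)]]
  by (simp add: mult_2 add_ac)

lemma word_in_pow:
  assumes S: "S \<subseteq> carrier G" and "word_in G S n g"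
  shows "word_in G S (k * n) (g [^] (k::nat))"
proof (induction k)
  case 0
  then show ?case by (simp add: word_in_one)
next
  case (Suc k)
  then show ?case
    using word_in_mult[OF S Suc assms(2)] by (simp add: add.commute)
qed

text \<open>
  Word length is subadditive along powers, so one short power \<open>g ^ m\<close> bounds the growth rate of all
  powers.
\<close>

lemma word_length_pow_sublinear:
  assumes S: "S \<subseteq> carrier G" and g: "word_in G S l g" "g \<in> carrier G"
    and short: "\<And>e. e > 0 \<Longrightarrow> \<exists>m n. m \<ge> 1 \<and> word_in G S n (g [^] (m::nat)) \<and> real n \<le> e * real m"
  shows "(\<lambda>n::nat. real (word_length G S (g [^] n)) / real n) \<longlonglongrightarrow> 0"
proof (rule LIMSEQ_I)
  fix r :: real assume r: "r > 0"
  obtain m n where m: "m \<ge> 1" and n: "word_in G S n (g [^] (m::nat))" "real n \<le> (r/2) * real m"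
    using short[of "r/2"] r by auto
  have bound: "real (word_length G S (g [^] k)) \<le> (r/2) * real k + real (m * l)" for k :: nat
  proof -
    \<comment> \<open>Division with remainder: the quotient is paid with the short word for
      \<open>g [^] m\<close>, and the remainder costs at most the constant
      \<open>m * l\<close>.\<close>
    have "g [^] k = (g [^] m) [^] (k div m) \<otimes> g [^] (k mod m)"
      using g(2) by (simp add: nat_pow_pow nat_pow_mult)
    then have "word_in G S (k div m * n + k mod m * l) (g [^] k)"
      using word_in_mult[OF S word_in_pow[OF S n(1)] word_in_pow[OF S g(1)]] by metis
    then have "word_length G S (g [^] k) \<le> k div m * n + k mod m * l"
      by (rule word_length_le)
    also have "k mod m * l \<le> m * l"
      using m by (intro mult_right_mono) (simp_all add: less_imp_le)
    finally have "real (word_length G S (g [^] k)) \<le> real (k div m) * real n + real (m * l)"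
      by (metis add_le_cancel_left of_nat_add of_nat_le_iff of_nat_mult)
    also have "real (k div m) * real n \<le> real (k div m) * ((r/2) * real m)"
      using n(2) by (intro mult_left_mono) auto
    also have "\<dots> = (r/2) * real (k div m * m)" by simp
    also have "\<dots> \<le> (r/2) * real k"
      using r by (intro mult_left_mono) (auto simp del: of_nat_mult)
    finally show ?thesis by simp
  qed
  \<comment> \<open>Beyond \<open>N\<close> the constant \<open>m * l\<close> is absorbed by the
    other half of \<open>r\<close>; \<open>Suc N\<close> keeps \<open>k\<close> positive for the
    division.\<close>
  obtain N :: nat where N: "real N > real (m * l) / (r/2)" using reals_Archimedean2 by blast
  show "\<exists>no. \<forall>k\<ge>no. norm (real (word_length G S (g [^] k)) / real k - 0) < r"
  proof (intro exI[of _ "Suc N"] allI impI)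
    fix k assume k: "k \<ge> Suc N"
    have "real (m * l) < (r/2) * real N"
      using N r by (simp add: pos_divide_less_eq mult.commute)
    also have "\<dots> \<le> (r/2) * real k" using k r by (intro mult_left_mono) auto
    finally have "real (word_length G S (g [^] k)) < r * real k"
      using bound[of k] by (simp add: field_simps)
    then show "norm (real (word_length G S (g [^] k)) / real k - 0) < r"
      using k by (simp add: pos_divide_less_eq)
  qed
qed

text \<open>
  The carrier \<open>C\<close> need not be known to be a subgroup: inverses computed in \<open>C\<close> of elements of a
  subgroup \<open>H \<subseteq> C\<close> are still the inverses of \<open>G\<close>.
\<close>

lemma subgroup_carrier_update:
  assumes H: "subgroup H G" "H \<subseteq> C" and C: "C \<subseteq> carrier G"
  shows "subgroup H (G\<lparr>carrier := C\<rparr>)"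
proof
  fix x assume x: "x \<in> H"
  have ix: "inv x \<in> H" "x \<in> carrier G" using x H subgroup.m_inv_closed subgroup.mem_carrier by fastforce+
  have "inv\<^bsub>G\<lparr>carrier := C\<rparr>\<^esub> x = inv x"
    unfolding m_inv_def[of "G\<lparr>carrier := C\<rparr>"]
  proof (rule the_equality)
    show "inv x \<in> carrier (G\<lparr>carrier := C\<rparr>) \<and> x \<otimes>\<^bsub>G\<lparr>carrier := C\<rparr>\<^esub> inv x = \<one>\<^bsub>G\<lparr>carrier := C\<rparr>\<^esub> \<and>
       inv x \<otimes>\<^bsub>G\<lparr>carrier := C\<rparr>\<^esub> x = \<one>\<^bsub>G\<lparr>carrier := C\<rparr>\<^esub>"
      using ix H by auto
  next
    fix y assume "y \<in> carrier (G\<lparr>carrier := C\<rparr>) \<and> x \<otimes>\<^bsub>G\<lparr>carrier := C\<rparr>\<^esub> y = \<one>\<^bsub>G\<lparr>carrier := C\<rparr>\<^esub> \<and>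
       y \<otimes>\<^bsub>G\<lparr>carrier := C\<rparr>\<^esub> x = \<one>\<^bsub>G\<lparr>carrier := C\<rparr>\<^esub>"
    then show "y = inv x"
      using C ix(2) inv_equality by (metis subsetD partial_object.select_convs(1) partial_object.surjective
          partial_object.update_convs(1) monoid.select_convs(1) monoid.select_convs(2) monoid.surjective)
  qed
  then show "inv\<^bsub>G\<lparr>carrier := C\<rparr>\<^esub> x \<in> H" using ix by simp
qed (use H in \<open>auto simp: subgroup.m_closed subgroup.one_closed\<close>)

text \<open>The witness is the subgroup generated by \<open>S\<close>. Restricting the carrier
  changes neither products and powers nor the inverses of generators, so word lengths in it can be
  computed in the ambient group.\<close>

lemma distortion_element_carrier_update:
  assumes S: "finite S" "S \<subseteq> carrier G" and g: "g \<in> S"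
    and C: "generate G S \<subseteq> C" "C \<subseteq> carrier G"
    and short: "\<And>e. e > 0 \<Longrightarrow> \<exists>m n. m \<ge> 1 \<and> word_in G S n (g [^] (m::nat)) \<and> real n \<le> e * real m"
  shows "distortion_element (G\<lparr>carrier := C\<rparr>) g"
proof -
  define H where "H = generate G S"
  define K where "K = G\<lparr>carrier := H\<rparr>"
  have H: "subgroup H G" unfolding H_def by (rule generate_is_subgroup) fact
  have SH: "S \<subseteq> H" unfolding H_def by (auto intro: generate.incl)
  have inv: "m_inv K ` S = m_inv G ` S"
    unfolding K_def using H SH by (intro image_cong) auto
  have K: "word_length K S = word_length G S"
    unfolding word_length_def inv by (simp add: K_def)
  have "(\<lambda>n::nat. real (word_length G S (g [^] n)) / real n) \<longlonglongrightarrow> 0"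
    using S g short by (intro word_length_pow_sublinear[where l = 1]) (use word_in_gen in auto)
  then have "(\<lambda>n::nat. real (word_length K S (g [^]\<^bsub>K\<^esub> n)) / real n) \<longlonglongrightarrow> 0"
    unfolding K by (simp add: K_def flip: nat_pow_consistent)
  moreover have "generate K S = carrier K"
    unfolding K_def using generate_consistent[OF SH H] by (simp add: H_def)
  ultimately have "distorted K g"
    unfolding distorted_def using S SH g by (auto simp: K_def)
  moreover have "subgroup H (G\<lparr>carrier := C\<rparr>)"
    using H C by (intro subgroup_carrier_update) (auto simp: H_def)
  ultimately show ?thesis
    unfolding distortion_element_def using SH g by (auto simp: K_def intro!: exI[of _ H])
qed

end


section \<open>Storing a sequence of functions in one function\<close>

text \<open>The interval [-3, 4] is the outermost of a nested family: the stored functions live on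
  [0, 1], their primitives \<open>D\<close> on [-1, 2], the expanding maps move only points of
  [-2, 3], and \<open>shift\<close> needs room to push [-2, 3] off itself.\<close>

definition supp_fun :: "(real \<Rightarrow> real) \<Rightarrow> bool" where
  "supp_fun \<theta> \<longleftrightarrow> continuous_on UNIV \<theta> \<and> (\<forall>y. y \<le> -3 \<or> y \<ge> 4 \<longrightarrow> \<theta> y = 0)"

text \<open>A strictly increasing surjection of the line is automatically a homeomorphism, so
  continuity is derived from this purely order-theoretic condition.\<close>

definition supp_homeo :: "(real \<Rightarrow> real) \<Rightarrow> bool" where
  "supp_homeo g \<longleftrightarrow> strict_mono g \<and> surj g \<and> (\<forall>y. y \<le> -3 \<or> y \<ge> 4 \<longrightarrow> g y = y)"

section \<open>Closure properties of supported functions and homeomorphisms\<close>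

lemma supp_homeo_bij: "supp_homeo g \<Longrightarrow> bij g"
  by (simp add: supp_homeo_def bij_def strict_mono_imp_inj_on)

lemma supp_homeo_continuous: "supp_homeo g \<Longrightarrow> continuous_on UNIV g"
  by (intro continuous_onI_mono) (auto simp: supp_homeo_def strict_mono_less_eq)

lemma supp_homeo_id: "supp_homeo id"
  by (simp add: supp_homeo_def strict_mono_def)

lemma supp_homeo_comp: "supp_homeo f \<Longrightarrow> supp_homeo g \<Longrightarrow> supp_homeo (f \<circ> g)"
  using comp_surj[of g f] by (auto simp: supp_homeo_def strict_mono_def comp_def)

lemma supp_homeo_funpow: "supp_homeo g \<Longrightarrow> supp_homeo (g ^^ n)"
  by (induction n) (simp_all add: supp_homeo_id supp_homeo_comp)

lemma supp_homeo_inv: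
  assumes "supp_homeo g"
  shows "supp_homeo (inv_into UNIV g)"
proof -
  have b: "bij g" using assms by (rule supp_homeo_bij)
  have "strict_mono (inv_into UNIV g)"
  proof (rule strict_monoI)
    fix x y :: real assume "x < y"
    moreover have "g (inv_into UNIV g z) = z" for z
      using b by (simp add: bij_is_surj surj_f_inv_f)
    ultimately show "inv_into UNIV g x < inv_into UNIV g y"
      using assms strict_mono_less[of g "inv_into UNIV g x" "inv_into UNIV g y"]
      by (simp add: supp_homeo_def)
  qed
  moreover have "inv_into UNIV g y = y" if "g y = y" for y
    using inv_f_f[OF bij_is_inj[OF b], of y] that by simp
  moreover have "surj (inv_into UNIV g)"
    using b by (intro bij_is_surj bij_imp_bij_inv)
  ultimately show ?thesis
    using assms unfolding supp_homeo_def by blast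
qed

lemma supp_fun_comp:
  assumes "supp_fun \<theta>" "supp_homeo g"
  shows "supp_fun (\<lambda>y. \<theta> (g y))"
  unfolding supp_fun_def
proof
  show "continuous_on UNIV (\<lambda>y. \<theta> (g y))"
    using assms(1) supp_homeo_continuous[OF assms(2)]
    by (intro continuous_on_compose2[of UNIV \<theta> UNIV g]) (auto simp: supp_fun_def)
  show "\<forall>y. y \<le> -3 \<or> y \<ge> 4 \<longrightarrow> \<theta> (g y) = 0"
    using assms by (simp add: supp_fun_def supp_homeo_def)
qed

lemma supp_fun_zero: "supp_fun (\<lambda>y. 0)"
  by (simp add: supp_fun_def)

lemma supp_fun_add: "supp_fun \<theta> \<Longrightarrow> supp_fun \<theta>' \<Longrightarrow> supp_fun (\<lambda>y. \<theta> y + \<theta>' y)"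
  by (auto simp: supp_fun_def intro: continuous_on_add)

lemma supp_fun_scale: "supp_fun \<theta> \<Longrightarrow> supp_fun (\<lambda>y. c * \<theta> y)"
  by (auto simp: supp_fun_def intro!: continuous_intros)

lemma supp_fun_minus: "supp_fun \<theta> \<Longrightarrow> supp_fun (\<lambda>y. - \<theta> y)"
  by (auto simp: supp_fun_def intro!: continuous_intros)

lemma supp_fun_sum:
  assumes "\<And>i. i \<in> I \<Longrightarrow> supp_fun (\<theta> i)"
  shows "supp_fun (\<lambda>y. \<Sum>i\<in>I. \<theta> i y)"
  using assms by (auto simp: supp_fun_def intro: continuous_on_sum)

text \<open>As \<open>k\<close> fixes both ends it preserves \<open>{a..b}\<close> and glues
  monotonically with the identity outside; surjectivity is the intermediate value theorem.\<close>

lemma supp_homeo_extend: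
  assumes ab: "-3 \<le> a" "a \<le> b" "b \<le> 4"
    and cont: "continuous_on {a..b} k"
    and mono: "\<And>x y. a \<le> x \<Longrightarrow> x < y \<Longrightarrow> y \<le> b \<Longrightarrow> k x < k y"
    and ends: "k a = a" "k b = b"
  shows "supp_homeo (\<lambda>y. if a \<le> y \<and> y \<le> b then k y else y)"
    (is "supp_homeo ?g")
proof -
  have m: "k x \<le> k y" if "a \<le> x" "x \<le> y" "y \<le> b" for x y
    using mono[of x y] that by (cases "x = y") auto
  have range: "a \<le> k y \<and> k y \<le> b" if "a \<le> y" "y \<le> b" for y
    using m[of a y] m[of y b] that ends by auto
  have "strict_mono ?g"
  proof (rule strict_monoI)
    fix x y :: real assume "x < y"
    then show "?g x < ?g y"
      using mono[of x y] range[of x] range[of y] by auto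
  qed
  moreover have "z \<in> range ?g" for z
  proof (cases "a \<le> z \<and> z \<le> b")
    case True
    then obtain x where "a \<le> x" "x \<le> b" "k x = z"
      using IVT'[of k a z b] ends ab cont by auto
    then show ?thesis by (intro image_eqI[of _ _ x]) auto
  next
    case False
    then show ?thesis by (intro image_eqI[of _ _ z]) auto
  qed
  moreover have "?g y = y" if "y \<le> -3 \<or> y \<ge> 4" for y
  proof -
    have "y < a \<or> y > b \<or> y = a \<or> y = b" using that ab by auto
    then show ?thesis using ends by auto
  qed
  ultimately show ?thesis
    unfolding supp_homeo_def by blast
qed

lemma continuous_suminf:
  fixes f :: "nat \<Rightarrow> real \<Rightarrow> real"
  assumes "\<And>n. continuous_on UNIV (f n)" "\<And>n y. \<bar>f n y\<bar> \<le> M n" "summable M"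
  shows "continuous_on UNIV (\<lambda>y. \<Sum>n. f n y)" "summable (\<lambda>n. f n y)"
proof -
  have "uniform_limit UNIV (\<lambda>n y. \<Sum>i<n. f i y) (\<lambda>y. \<Sum>n. f n y) sequentially"
    using assms by (intro Weierstrass_m_test) auto
  then show "continuous_on UNIV (\<lambda>y. \<Sum>n. f n y)"
    using assms(1) by (intro uniform_limit_theorem[where F = sequentially]) (auto intro!: always_eventually continuous_on_sum)
  show "summable (\<lambda>n. f n y)"
    by (rule summable_comparison_test[OF _ assms(3)]) (use assms(2) in auto)
qed

text \<open>Two lines meeting at (0, 2): slope 3 blows [-1, 0] up onto [-1, 2], and slope 1/3
  squeezes [0, 3] onto [2, 3]. The reflection y -> 1 - y conjugates this map to
  \<open>right_expand\<close>.\<close>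

definition left_expand :: "real \<Rightarrow> real" where
  "left_expand y = (if -1 \<le> y \<and> y \<le> 3 then min (3 * y + 2) (y / 3 + 2) else y)"

definition right_expand :: "real \<Rightarrow> real" where
  "right_expand y = (if -2 \<le> y \<and> y \<le> 2 then max (3 * y - 4) ((y - 4) / 3) else y)"

text \<open>The two lines meet at (3, -2), so everything in [-2, 3] is moved into [-3, -2].\<close>

definition shift :: "real \<Rightarrow> real" where
  "shift y = (if -3 \<le> y \<and> y \<le> 4 then max ((y + 3) / 6 - 3) (6 * y - 20) else y)"

definition unshift :: "real \<Rightarrow> real" where
  "unshift = inv_into UNIV shift"

lemma max_less_max: "a < c \<Longrightarrow> b < d \<Longrightarrow> max a b < max c (d :: real)"
  by (auto simp: max_def)

lemma supp_homeo_left_expand: "supp_homeo left_expand"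
  unfolding left_expand_def
proof (rule supp_homeo_extend)
  show "continuous_on {-1..3::real} (\<lambda>y. min (3 * y + 2) (y / 3 + 2))"
    by (intro continuous_intros) auto
  show "min (3 * x + 2) (x / 3 + 2) < min (3 * y + 2) (y / 3 + 2)" if "x < y" for x y :: real
    using that by linarith
qed auto

lemma supp_homeo_right_expand: "supp_homeo right_expand"
  unfolding right_expand_def
proof (rule supp_homeo_extend)
  show "continuous_on {-2..2::real} (\<lambda>y. max (3 * y - 4) ((y - 4) / 3))"
    by (intro continuous_intros) auto
  show "max (3 * x - 4) ((x - 4) / 3) < max (3 * y - 4) ((y - 4) / 3)" if "x < y" for x y :: real
    using that by (intro max_less_max) auto
qed auto

lemma supp_homeo_shift: "supp_homeo shift"
  unfolding shift_def
proof (rule supp_homeo_extend)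
  show "continuous_on {-3..4::real} (\<lambda>y. max ((y + 3) / 6 - 3) (6 * y - 20))"
    by (intro continuous_intros) auto
  show "max ((x + 3) / 6 - 3) (6 * x - 20) < max ((y + 3) / 6 - 3) (6 * y - 20)" if "x < y" for x y :: real
    using that by (intro max_less_max) auto
qed auto

text \<open>
  The inverses of \<^const>\<open>left_expand\<close> and \<^const>\<open>right_expand\<close> map \<open>[-1, 2]\<close> affinely onto its left
  and right thirds, so that the images of the middle third \<open>[0, 1]\<close> under their compositions are
  the pairwise disjoint gaps of a Cantor set. The function \<open>D\<close> is \<open>\<eta> / 2\<close> on \<open>[0, 1]\<close>, and on each
  gap it is half of a rescaled copy of its values on the parent gap.
\<close>

lemma cantor_coboundary:
  fixes \<eta> :: "real \<Rightarrow> real"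
  assumes cont: "continuous_on UNIV \<eta>" and supp: "\<And>y. y \<le> 0 \<or> y \<ge> 1 \<Longrightarrow> \<eta> y = 0"
    and bound: "\<And>y. \<bar>\<eta> y\<bar> \<le> c"
  shows "\<exists>D. continuous_on UNIV D \<and> (\<forall>y. y \<le> -1 \<or> y \<ge> 2 \<longrightarrow> D y = 0) \<and> (\<forall>y. \<bar>D y\<bar> \<le> c) \<and>
     (\<forall>y. \<eta> y = 2 * D y - D (left_expand y) - D (right_expand y))"
proof -
  \<comment> \<open>The equation to solve reads D = \<eta>/2 + (D o left_expand + D o
    right_expand)/2. Iterating it from \<eta>/2 produces the terms \<open>E n\<close> of a Neumann
    series.\<close>
  define E where "E = rec_nat (\<lambda>y. \<eta> y / 2) (\<lambda>n e y. (e (left_expand y) + e (right_expand y)) / 2)"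
  have E0: "E 0 = (\<lambda>y. \<eta> y / 2)"
    and ES: "E (Suc n) = (\<lambda>y. (E n (left_expand y) + E n (right_expand y)) / 2)" for n
    by (simp_all add: E_def)
  have contE: "continuous_on UNIV (E n)" for n
  proof (induction n)
    case 0
    then show ?case using cont by (auto simp: E0 intro!: continuous_intros)
  next
    case (Suc n)
    have "continuous_on UNIV (\<lambda>y. E n (left_expand y))" "continuous_on UNIV (\<lambda>y. E n (right_expand y))"
      using Suc supp_homeo_continuous[OF supp_homeo_left_expand] supp_homeo_continuous[OF supp_homeo_right_expand]
      by (auto intro: continuous_on_compose2[of UNIV "E n"])
    then show ?case by (auto simp: ES intro!: continuous_intros)
  qed
  have suppE: "E n y = 0" if "y \<le> -1 \<or> y \<ge> 2" for n y
    using that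
  proof (induction n arbitrary: y)
    case 0
    then show ?case using supp[of y] by (auto simp: E0)
  next
    case (Suc n)
    have "left_expand y \<le> -1 \<or> left_expand y \<ge> 2"
      using Suc.prems by (auto simp: left_expand_def min_def)
    moreover have "right_expand y \<le> -1 \<or> right_expand y \<ge> 2"
      using Suc.prems by (auto simp: right_expand_def max_def)
    ultimately show ?case using Suc.IH by (auto simp: ES)
  qed
  have c: "c \<ge> 0" using bound[of 0] by auto
  have boundE: "\<bar>E n y\<bar> \<le> (c / 2) * (1/2) ^ n" for n y
  proof (induction n arbitrary: y)
    case 0
    then show ?case using bound[of y] by (simp add: E0)
  next
    case (Suc n)
    \<comment> \<open>At every point one of the two summands vanishes, so the averaging really
      halves the supremum; this makes the series converge geometrically.\<close>
    have "E n (left_expand y) = 0 \<or> E n (right_expand y) = 0"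
    proof (cases "y \<ge> 0")
      case True
      then have "left_expand y \<ge> 2" by (auto simp: left_expand_def min_def)
      then show ?thesis using suppE by simp
    next
      case False
      then have "right_expand y \<le> -1" by (auto simp: right_expand_def max_def)
      then show ?thesis using suppE by simp
    qed
    then show ?case
      using Suc[of "left_expand y"] Suc[of "right_expand y"] by (auto simp: ES)
  qed
  have sum: "(\<lambda>n. (c / 2) * (1/2) ^ n) sums c"
    using sums_mult[OF geometric_sums[of "1/2::real"], of "c/2"] by simp
  define D where "D y = (\<Sum>n. E n y)" for y
  note ms = continuous_suminf[OF contE boundE sums_summable[OF sum]]
  have "\<bar>D y\<bar> \<le> c" for y
  proof -
    have s: "summable (\<lambda>n. \<bar>E n y\<bar>)"
      by (rule summable_rabs_comparison_test[OF _ sums_summable[OF sum]]) (use boundE in blast)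
    then have "\<bar>D y\<bar> \<le> (\<Sum>n. \<bar>E n y\<bar>)"
      unfolding D_def by (rule summable_rabs)
    also have "\<dots> \<le> (\<Sum>n. (c / 2) * (1/2) ^ n)"
      using boundE s sums_summable[OF sum] by (intro suminf_le) auto
    finally have "\<bar>D y\<bar> \<le> (\<Sum>n. (c / 2) * (1/2) ^ n)" .
    then show ?thesis using sums_unique[OF sum] by simp
  qed
  moreover have "\<eta> y = 2 * D y - D (left_expand y) - D (right_expand y)" for y
  proof -
    have "D y = E 0 y + (\<Sum>n. E (Suc n) y)"
      unfolding D_def using suminf_split_head[OF ms(2)[of y]] by simp
    also have "(\<Sum>n. E (Suc n) y) = (D (left_expand y) + D (right_expand y)) / 2"
      unfolding D_def ES using ms(2) by (simp add: suminf_add suminf_divide summable_add)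
    finally show ?thesis by (simp add: E0 field_simps)
  qed
  moreover have "D y = 0" if "y \<le> -1 \<or> y \<ge> 2" for y
    using suppE[OF that] by (simp add: D_def)
  moreover have "continuous_on UNIV D" using ms(1) by (simp add: D_def[abs_def])
  ultimately show ?thesis by blast
qed

section \<open>Displacement of [-2, 3] by the iterates of the shift\<close>

lemma supp_homeo_unshift: "supp_homeo unshift"
  unfolding unshift_def by (intro supp_homeo_inv supp_homeo_shift)

lemma shift_le: "shift y \<le> y"
  by (auto simp: shift_def max_def field_simps)

text \<open>The first application already lands at or below -2, and \<open>shift\<close> never moves
  a point up.\<close>

lemma shift_funpow_le: "n > 0 \<Longrightarrow> y \<le> 3 \<Longrightarrow> (shift ^^ n) y \<le> -2"
proof (induction n)
  case (Suc n)
  show ?case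
  proof (cases "n = 0")
    case True
    then show ?thesis using Suc.prems by (auto simp: shift_def max_def)
  next
    case False
    then show ?thesis using Suc shift_le[of "(shift ^^ n) y"] by simp
  qed
qed simp

text \<open>A value below 3 would be brought back by \<open>shift ^^ n\<close> to a point strictly
  below -2.\<close>

lemma inv_shift_funpow_ge:
  assumes "n > 0" "y \<ge> -2"
  shows "(unshift ^^ n) y \<ge> 3"
proof (rule ccontr)
  assume "\<not> (unshift ^^ n) y \<ge> 3"
  then have "(unshift ^^ n) y < 3" by simp
  then have "(shift ^^ n) ((unshift ^^ n) y) < (shift ^^ n) 3"
    using supp_homeo_funpow[OF supp_homeo_shift, of n] by (simp add: supp_homeo_def strict_mono_less)
  moreover have "(shift ^^ n) ((unshift ^^ n) y) = y"
    using fn_o_inv_fn_is_id[OF supp_homeo_bij[OF supp_homeo_shift], of n] by (simp add: fun_eq_iff unshift_def)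
  ultimately show False using shift_funpow_le[of n 3] assms by simp
qed

text \<open>Tells which point the function stored in slot \<open>j\<close> is evaluated at when slot
  \<open>k\<close> is read.\<close>

lemma inv_shift_shift_funpow:
  "(unshift ^^ j) ((shift ^^ k) y) = (if j \<le> k then (shift ^^ (k - j)) y else (unshift ^^ (j - k)) y)"
proof -
  have i: "(unshift ^^ n) ((shift ^^ n) z) = z" for n z
    using inv_fn_o_fn_is_id[OF supp_homeo_bij[OF supp_homeo_shift], of n] by (simp add: fun_eq_iff unshift_def)
  show ?thesis
  proof (cases "j \<le> k")
    case True
    then have "(shift ^^ k) y = (shift ^^ j) ((shift ^^ (k - j)) y)"
      using funpow_add[of j "k - j" shift] by (simp add: fun_eq_iff)
    then show ?thesis using i True by simp
  next
    case False
    then have "(unshift ^^ j) ((shift ^^ k) y) = (unshift ^^ (j - k)) ((unshift ^^ k) ((shift ^^ k) y))"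
      using funpow_add[of "j - k" k unshift] by (simp add: fun_eq_iff)
    then show ?thesis using i False by simp
  qed
qed

text \<open>
  Iterates of \<^const>\<open>shift\<close> move the common support \<open>[-2, 3]\<close> of \<^const>\<open>left_expand\<close> and
  \<^const>\<open>right_expand\<close> off itself, so one function \<open>\<Theta>\<close> stores a whole sequence. The coefficients
  \<open>2, -1, -1\<close> add up to 0, which kills the other stored functions upon extraction.
\<close>

lemma universal_twist:
  fixes \<eta> :: "nat \<Rightarrow> real \<Rightarrow> real"
  assumes cont: "\<And>k. continuous_on UNIV (\<eta> k)" and supp: "\<And>k y. y \<le> 0 \<or> y \<ge> 1 \<Longrightarrow> \<eta> k y = 0"
    and bound: "\<And>k y. \<bar>\<eta> k y\<bar> \<le> (1/2) ^ k"
  shows "\<exists>\<Theta>. supp_fun \<Theta> \<and> (\<forall>k y. \<eta> k y = 2 * \<Theta> ((shift ^^ k) y)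
     - \<Theta> ((shift ^^ k) (left_expand y)) - \<Theta> ((shift ^^ k) (right_expand y)))"
proof -
  have "\<forall>k. \<exists>D. continuous_on UNIV D \<and> (\<forall>y. y \<le> -1 \<or> y \<ge> 2 \<longrightarrow> D y = 0) \<and> (\<forall>y. \<bar>D y\<bar> \<le> (1/2) ^ k) \<and>
     (\<forall>y. \<eta> k y = 2 * D y - D (left_expand y) - D (right_expand y))"
    using cantor_coboundary[OF cont supp bound] by blast
  from choice[OF this] obtain D where contD: "\<And>k. continuous_on UNIV (D k)"
    and suppD: "\<And>k y. y \<le> -1 \<or> y \<ge> 2 \<Longrightarrow> D k y = 0"
    and boundD: "\<And>k y. \<bar>D k y\<bar> \<le> (1/2) ^ k"
    and D: "\<And>k y. \<eta> k y = 2 * D k y - D k (left_expand y) - D k (right_expand y)"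
    by blast
  \<comment> \<open>Slot \<open>j\<close> holds \<open>D j\<close> transported by
    \<open>shift ^^ j\<close>; the intervals \<open>shift ^^ j\<close> of [-1, 2] are
    disjoint.\<close>
  define \<Theta> where "\<Theta> y = (\<Sum>j. D j ((unshift ^^ j) y))" for y
  have inv: "supp_homeo (unshift ^^ j)" for j
    by (intro supp_homeo_funpow supp_homeo_unshift)
  have "continuous_on UNIV (\<lambda>y. D j ((unshift ^^ j) y))" for j
    using contD supp_homeo_continuous[OF inv[of j]] by (auto intro: continuous_on_compose2[of UNIV "D j"])
  then have "continuous_on UNIV \<Theta>"
    unfolding \<Theta>_def[abs_def]
    by (rule continuous_suminf(1)) (rule boundD, simp add: summable_geometric)
  moreover have "\<Theta> y = 0" if "y \<le> -3 \<or> y \<ge> 4" for y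
  proof -
    have "(unshift ^^ j) y = y" for j
      using inv[of j] that unfolding supp_homeo_def by blast
    moreover have "D j y = 0" for j using that by (intro suppD) auto
    ultimately show ?thesis by (simp add: \<Theta>_def)
  qed
  ultimately have "supp_fun \<Theta>" by (simp add: supp_fun_def)
  moreover have "\<eta> k y = 2 * \<Theta> ((shift ^^ k) y)
     - \<Theta> ((shift ^^ k) (left_expand y)) - \<Theta> ((shift ^^ k) (right_expand y))" for k y
  proof -
    have \<Theta>: "\<Theta> ((shift ^^ k) z) = D k z" if z: "-2 \<le> z" "z \<le> 3" for z
    proof -
      \<comment> \<open>For j < k the argument is at most -2, for j > k at least 3; both lie outside
        the support [-1, 2] of \<open>D j\<close>.\<close>
      have "D j ((unshift ^^ j) ((shift ^^ k) z)) = 0" if "j \<noteq> k" for j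
        unfolding inv_shift_shift_funpow
        using that shift_funpow_le[of "k - j" z] inv_shift_funpow_ge[of "j - k" z] z
        by (intro suppD) auto
      then have "\<Theta> ((shift ^^ k) z) = (\<Sum>j\<in>{k}. D j ((unshift ^^ j) ((shift ^^ k) z)))"
        unfolding \<Theta>_def by (intro suminf_finite) auto
      then show ?thesis by (simp add: inv_shift_shift_funpow)
    qed
    show ?thesis
    proof (cases "-2 \<le> y \<and> y \<le> 3")
      case True
      then have "-2 \<le> left_expand y" "left_expand y \<le> 3" "-2 \<le> right_expand y" "right_expand y \<le> 3"
        by (auto simp: left_expand_def right_expand_def min_def max_def)
      then show ?thesis using True D \<Theta> by simp
    next
      case False
      then have "left_expand y = y" "right_expand y = y"
        by (auto simp: left_expand_def right_expand_def)
      moreover have "\<eta> k y = 0" using False by (intro supp) auto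
      ultimately show ?thesis by simp
    qed
  qed
  ultimately show ?thesis by blast
qed


section \<open>Birkhoff sums along the push\<close>

definition push :: "real \<Rightarrow> real" where
  "push y = (if 0 \<le> y \<and> y \<le> 1 then 2 * y / (1 + y) else y)"

definition odds_square :: "real \<Rightarrow> real" where
  "odds_square y = (if 0 \<le> y \<and> y \<le> 1 then y\<^sup>2 / (y\<^sup>2 + (1 - y)\<^sup>2) else y)"

lemma supp_homeo_push: "supp_homeo push"
  unfolding push_def
proof (rule supp_homeo_extend)
  show "continuous_on {0..1::real} (\<lambda>y. 2 * y / (1 + y))"
    by (auto intro!: continuous_intros)
  show "2 * x / (1 + x) < 2 * y / (1 + y)" if "0 \<le> x" "x < y" for x y :: real
    using that by (simp add: divide_simps) (simp add: algebra_simps)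
qed auto

lemma odds_denom_pos: "y\<^sup>2 + (1 - y)\<^sup>2 > (0::real)"
  by (cases "y = 0") (auto simp: add_pos_nonneg)

lemma supp_homeo_odds_square: "supp_homeo odds_square"
  unfolding odds_square_def
proof (rule supp_homeo_extend)
  show "continuous_on {0..1::real} (\<lambda>y. y\<^sup>2 / (y\<^sup>2 + (1 - y)\<^sup>2))"
    using odds_denom_pos by (intro continuous_intros) (metis less_irrefl)
  show "x\<^sup>2 / (x\<^sup>2 + (1 - x)\<^sup>2) < y\<^sup>2 / (y\<^sup>2 + (1 - y)\<^sup>2)" if "0 \<le> x" "x < y" "y \<le> 1" for x y :: real
  proof -
    \<comment> \<open>Comparison of the odds x/(1 - x) and y/(1 - y), cross-multiplied so that the
      endpoint 1 is covered.\<close>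
    have "x * (1 - y) < y * (1 - x)" using that by (simp add: algebra_simps)
    then have "(x * (1 - y))\<^sup>2 < (y * (1 - x))\<^sup>2" using that by (intro power_strict_mono) auto
    then have "x\<^sup>2 * (y\<^sup>2 + (1 - y)\<^sup>2) < y\<^sup>2 * (x\<^sup>2 + (1 - x)\<^sup>2)"
      unfolding power_mult_distrib distrib_left by simp
    then show ?thesis
      using odds_denom_pos[of x] odds_denom_pos[of y] by (simp add: divide_simps)
  qed
qed auto

text \<open>In terms of the odds \<open>y / (1 - y)\<close>, \<^const>\<open>push\<close> is doubling and \<^const>\<open>odds_square\<close> is squaring.\<close>

lemma odds_square_push: "odds_square (push y) = push (push (odds_square y))"
proof (cases "0 \<le> y \<and> y \<le> 1")
  case True
  have p: "0 \<le> push y" "push y \<le> 1" using True by (auto simp: push_def divide_simps)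
  \<comment> \<open>Both sides turn out to be 4 y^2 / (4 y^2 + (1 - y)^2): the squared odds are
    multiplied by 4.\<close>
  define d where "d = y\<^sup>2 + (1 - y)\<^sup>2"
  have d: "d > 0" unfolding d_def by (rule odds_denom_pos)
  have "odds_square (push y) = (2 * y / (1 + y))\<^sup>2 / ((2 * y / (1 + y))\<^sup>2 + ((1 - y) / (1 + y))\<^sup>2)"
  proof -
    have "1 - push y = (1 - y) / (1 + y)" using True by (simp add: push_def divide_simps)
    moreover have "push y = 2 * y / (1 + y)" using True by (simp add: push_def)
    ultimately show ?thesis using p unfolding odds_square_def by simp
  qed
  also have "\<dots> = 4 * y\<^sup>2 / (4 * y\<^sup>2 + (1 - y)\<^sup>2)"
    using True by (simp add: power_divide power_mult_distrib flip: add_divide_distrib)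
  finally have 1: "odds_square (push y) = 4 * y\<^sup>2 / (4 * y\<^sup>2 + (1 - y)\<^sup>2)" .
  have o: "odds_square y = y\<^sup>2 / d" using True by (simp add: odds_square_def d_def)
  have "0 \<le> y\<^sup>2 / d" "y\<^sup>2 / d \<le> 1" using d by (auto simp: d_def divide_simps)
  then have q: "push (odds_square y) = 2 * y\<^sup>2 / (d + y\<^sup>2)"
    using d unfolding o push_def by (simp add: divide_simps add.commute)
  have "0 \<le> 2 * y\<^sup>2 / (d + y\<^sup>2)" "2 * y\<^sup>2 / (d + y\<^sup>2) \<le> 1"
    using d by (auto simp: divide_simps add_pos_nonneg) (auto simp: d_def)
  then have "push (2 * y\<^sup>2 / (d + y\<^sup>2)) = 2 * (2 * y\<^sup>2 / (d + y\<^sup>2)) / (1 + 2 * y\<^sup>2 / (d + y\<^sup>2))"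
    by (simp add: push_def)
  also have "\<dots> = 4 * y\<^sup>2 / (d + 3 * y\<^sup>2)"
  proof -
    have "d + y\<^sup>2 > 0" using d by (simp add: add_pos_nonneg)
    then have "1 + 2 * y\<^sup>2 / (d + y\<^sup>2) = (d + 3 * y\<^sup>2) / (d + y\<^sup>2)" by (simp add: field_simps)
    then show ?thesis using \<open>d + y\<^sup>2 > 0\<close> by simp
  qed
  also have "d + 3 * y\<^sup>2 = 4 * y\<^sup>2 + (1 - y)\<^sup>2" by (simp add: d_def)
  finally show ?thesis using 1 q by simp
next
  case False
  then have "push y = y" "odds_square y = y" unfolding push_def odds_square_def by auto
  then show ?thesis by simp
qed

text \<open>Each conjugation by \<open>odds_square\<close> doubles the exponent of
  \<open>push\<close>. This is why the power \<open>2 ^ m\<close> of \<open>push\<close> has word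
  length linear in \<open>m\<close>.\<close>

lemma odds_square_push_funpow:
  "(odds_square ^^ m) (push y) = (push ^^ (2 ^ m)) ((odds_square ^^ m) y)"
proof -
  have step: "odds_square ((push ^^ j) y) = (push ^^ (2 * j)) (odds_square y)" for j y
    by (induction j) (simp_all add: odds_square_push)
  show ?thesis
    by (induction m) (simp_all add: step)
qed

text \<open>The odds are multiplied by \<open>2 ^ n\<close>; the formula is cleared of the
  denominator 1 - y and so holds at y = 1 too.\<close>

lemma push_funpow:
  assumes "0 \<le> y" "y \<le> 1"
  shows "(push ^^ n) y = 2 ^ n * y / (1 + (2 ^ n - 1) * y)"
proof (induction n)
  case (Suc n)
  define d where "d = 1 + (2 ^ n - 1) * y"
  have d: "d > 0" unfolding d_def using assms by (intro add_pos_nonneg) auto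
  have *: "2 ^ n * y \<le> d" "0 \<le> 2 ^ n * y" using assms by (auto simp: d_def algebra_simps)
  have "(push ^^ Suc n) y = push (2 ^ n * y / d)" using Suc by (simp add: d_def)
  also have "\<dots> = 2 * (2 ^ n * y) / (d + 2 ^ n * y)"
    using d * by (simp add: push_def divide_simps)
  also have "d + 2 ^ n * y = 1 + (2 ^ Suc n - 1) * y" by (simp add: d_def algebra_simps)
  finally show ?case by (simp add: mult.assoc)
qed simp

lemma push_funpow_eventually_gt:
  assumes "0 < a" "a < 1" "b < 1"
  shows "\<exists>M. (push ^^ M) a > b"
proof -
  \<comment> \<open>The goal amounts to b (1 - a) < 2^M a (1 - b), and its left side is below
    1.\<close>
  obtain M :: nat where M: "2 ^ M > 1 / (a * (1 - b))" using real_arch_pow[of 2] by auto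
  have "1 < 2 ^ M * (a * (1 - b))"
    using M assms by (simp add: pos_divide_less_eq)
  then have "b * (2 ^ M * a) < 2 ^ M * a - 1" by (simp add: algebra_simps)
  moreover have "b * (1 - a) < 1"
  proof (cases "b \<ge> 0")
    case True
    then have "b * (1 - a) \<le> b * 1" using assms by (intro mult_left_mono) auto
    then show ?thesis using assms by simp
  next
    case False
    then have "b * (1 - a) \<le> 0" using assms by (intro mult_nonpos_nonneg) auto
    then show ?thesis by simp
  qed
  ultimately have "b * (1 + (2 ^ M - 1) * a) < 2 ^ M * a" by (simp add: algebra_simps)
  moreover have "1 + (2 ^ M - 1) * a > 0" using assms by (intro add_pos_nonneg) auto
  ultimately have "(push ^^ M) a > b" using assms by (simp add: push_funpow pos_less_divide_eq)
  then show ?thesis ..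
qed

text \<open>
  An orbit of \<^const>\<open>push\<close> spends at most \<open>M\<close> steps in a compact subinterval of \<open>(0, 1)\<close>, and \<open>\<phi>\<close> is
  small outside of such an interval.
\<close>

lemma birkhoff_sum_sublinear:
  fixes \<phi> :: "real \<Rightarrow> real"
  assumes cont: "continuous_on UNIV \<phi>" and supp: "\<And>y. y \<le> 0 \<or> y \<ge> 1 \<Longrightarrow> \<phi> y = 0" and e: "e > 0"
  shows "\<exists>N. \<forall>n\<ge>N. \<forall>y. \<bar>\<Sum>i<n. \<phi> ((push ^^ i) y)\<bar> \<le> e * real n"
proof -
  have "isCont \<phi> 0" "isCont \<phi> 1" using cont by (auto simp: continuous_on_eq_continuous_at)
  then obtain a' b' where a': "a' > 0" "\<And>y. dist y 0 < a' \<Longrightarrow> dist (\<phi> y) (\<phi> 0) < e / 2"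
    and b': "b' > 0" "\<And>y. dist y 1 < b' \<Longrightarrow> dist (\<phi> y) (\<phi> 1) < e / 2"
    using e unfolding continuous_at_eps_delta by (metis half_gt_zero)
  \<comment> \<open>Halving stays strictly inside the neighbourhoods given by continuity; the cap
    1/2 keeps \<open>a\<close> and \<open>b\<close> in (0, 1).\<close>
  define a where "a = min (a' / 2) (1 / 2)"
  define b where "b = max (1 - b' / 2) (1 / 2)"
  have ab: "0 < a" "a < 1" "b < 1" using a' b' by (auto simp: a_def b_def)
  have small: "\<bar>\<phi> y\<bar> \<le> e / 2" if "y < a \<or> y > b" for y
  proof (cases "y \<le> 0 \<or> y \<ge> 1")
    case True
    then show ?thesis using supp[of y] e by simp
  next
    case False
    then have "dist y 0 < a' \<or> dist y 1 < b'"
      using that a' b' by (auto simp: a_def b_def dist_real_def)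
    then show ?thesis using a'(2)[of y] b'(2)[of y] supp[of 0] supp[of 1] by (auto simp: dist_real_def)
  qed
  obtain M where M: "(push ^^ M) a > b" using push_funpow_eventually_gt ab by blast
  have "compact (\<phi> ` {0..1})"
    using cont by (intro compact_continuous_image) (auto intro: continuous_on_subset)
  then obtain B where B: "\<forall>x\<in>\<phi> ` {0..1}. norm x \<le> B" using compact_imp_bounded bounded_iff by metis
  have B: "\<bar>\<phi> y\<bar> \<le> B" for y
    using B supp[of y] by (cases "y \<in> {0..1}") fastforce+
  have B0: "B \<ge> 0" using B[of 0] by auto
  have mono: "(push ^^ j) x \<le> (push ^^ j) y" if "x \<le> y" for j x y
    using supp_homeo_funpow[OF supp_homeo_push, of j] that by (simp add: supp_homeo_def strict_mono_less_eq)
  have up: "y \<le> push y" for y by (auto simp: push_def divide_simps) (auto simp: algebra_simps mult_left_le)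
  have up: "y \<le> (push ^^ j) y" for j y
    by (induction j) (use up order_trans in auto)
  have est: "\<bar>\<Sum>i<n. \<phi> ((push ^^ i) y)\<bar> \<le> e / 2 * real n + B * real M" for n y
  proof -
    define I where "I = {i \<in> {..<n}. a \<le> (push ^^ i) y \<and> (push ^^ i) y \<le> b}"
    have "card I \<le> M"
    proof (cases "I = {}")
      case False
      define i0 where "i0 = Min I"
      have fin: "finite I" by (simp add: I_def)
      have i0: "i0 \<in> I" unfolding i0_def using fin False by (rule Min_in)
      \<comment> \<open>At the first visit \<open>i0\<close> the orbit is at least \<open>a\<close>;
        by monotonicity it is above \<open>b\<close> after \<open>M\<close> more steps and stays
        there.\<close>
      have "I \<subseteq> {i0..<i0 + M}"
      proof
        fix i assume i: "i \<in> I"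
        have "i0 \<le> i" unfolding i0_def using fin i by (rule Min_le)
        moreover have "i < i0 + M"
        proof (rule ccontr)
          assume "\<not> i < i0 + M"
          then have "i = (i - i0 - M) + (M + i0)" by simp
          then have "(push ^^ i) y = (push ^^ (i - i0 - M)) ((push ^^ M) ((push ^^ i0) y))"
            by (metis comp_apply funpow_add)
          also have "\<dots> \<ge> (push ^^ M) ((push ^^ i0) y)" by (rule up)
          also have "(push ^^ M) ((push ^^ i0) y) \<ge> (push ^^ M) a"
            using i0 by (intro mono) (simp add: I_def)
          finally show False using M i by (simp add: I_def)
        qed
        ultimately show "i \<in> {i0..<i0 + M}" by simp
      qed
      then show ?thesis using card_mono[of "{i0..<i0 + M}" I] by simp
    qed simp
    have "\<bar>\<Sum>i<n. \<phi> ((push ^^ i) y)\<bar> \<le> (\<Sum>i<n. \<bar>\<phi> ((push ^^ i) y)\<bar>)" by (rule sum_abs)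
    also have "\<dots> \<le> (\<Sum>i<n. e / 2 + (if i \<in> I then B else 0))"
    proof (rule sum_mono)
      fix i assume "i \<in> {..<n}"
      then show "\<bar>\<phi> ((push ^^ i) y)\<bar> \<le> e / 2 + (if i \<in> I then B else 0)"
        using small[of "(push ^^ i) y"] B[of "(push ^^ i) y"] e by (auto simp: I_def)
    qed
    also have "\<dots> = e / 2 * real n + B * real (card I)"
      by (simp add: sum.distrib I_def flip: sum.inter_filter)
    also have "\<dots> \<le> e / 2 * real n + B * real M"
      using \<open>card I \<le> M\<close> B0 by (simp add: mult_left_mono)
    finally show ?thesis .
  qed
  obtain N :: nat where N: "real N \<ge> B * real M / (e / 2)" using real_arch_simple by blast
  show ?thesis
  proof (intro exI[of _ N] allI impI)
    fix n y assume "N \<le> n"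
    then have "B * real M / (e / 2) \<le> real n" using N by linarith
    then have "B * real M \<le> e / 2 * real n" using e by (simp add: pos_divide_le_eq mult.commute)
    then show "\<bar>\<Sum>i<n. \<phi> ((push ^^ i) y)\<bar> \<le> e * real n"
      using est[of y n] by simp
  qed
qed

text \<open>
  With \<open>r n\<close> the supremum of \<open>v m / m\<close> over \<open>m > n\<close>, the series \<open>\<phi>\<close> telescopes to at least \<open>r i\<close> at
  the \<open>i\<close>-th point of the orbit of \<open>1/2\<close>.
\<close>

lemma ex_birkhoff_sum_ge:
  fixes v :: "nat \<Rightarrow> real"
  assumes v: "(\<lambda>n. v n / real n) \<longlonglongrightarrow> 0" and pos: "\<And>n. n \<ge> 1 \<Longrightarrow> v n > 0"
  shows "\<exists>\<phi>. continuous_on UNIV \<phi> \<and> (\<forall>y. y \<le> 0 \<or> y \<ge> 1 \<longrightarrow> \<phi> y = 0) \<and>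
     (\<forall>n\<ge>1. (\<Sum>i<n. \<phi> ((push ^^ i) (1/2))) \<ge> v n)"
proof -
  \<comment> \<open>The index is shifted because a Birkhoff sum of \<open>n\<close> terms ends at
    the orbit point n - 1, where \<open>r (n - 1)\<close> must dominate
    \<open>v n / n\<close>.\<close>
  define u where "u n = v (Suc n) / real (Suc n)" for n
  have u: "u \<longlonglongrightarrow> 0" using LIMSEQ_Suc[OF v] by (simp add: u_def[abs_def])
  have upos: "u n > 0" for n using pos[of "Suc n"] by (simp add: u_def)
  have bdd: "bdd_above (u ` A)" for A
    using convergent_imp_Bseq[OF convergentI[OF u]] by (meson Bseq_eq_bounded bdd_above_mono bounded_imp_bdd_above image_mono subset_UNIV)
  define r where "r n = (SUP m\<in>{n..}. u m)" for n
  have ur: "u m \<le> r n" if "n \<le> m" for m n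
    unfolding r_def using that bdd by (intro cSUP_upper) auto
  have r_dec: "r n \<le> r m" if "m \<le> n" for m n
    unfolding r_def using that bdd by (intro cSUP_subset_mono) auto
  have r0: "r \<longlonglongrightarrow> 0"
  proof (rule LIMSEQ_I)
    fix e :: real assume e: "e > 0"
    then obtain N where N: "\<And>n. n \<ge> N \<Longrightarrow> u n < e / 2"
      using LIMSEQ_D[OF u, of "e/2"] upos by (auto simp: abs_of_pos)
    have "norm (r n - 0) < e" if "n \<ge> N" for n
    proof -
      have "r n \<le> e / 2" unfolding r_def using N that by (intro cSUP_least) (auto intro: less_imp_le)
      moreover have "r n > 0" using ur[of n n] upos[of n] by simp
      ultimately show ?thesis using e by simp
    qed
    then show "\<exists>N. \<forall>n\<ge>N. norm (r n - 0) < e" by blast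
  qed
  \<comment> \<open>A trapezoid vanishing outside (0, 1) and equal to 1 from 1/2 up to 2^m / (1 +
    2^m), which is the \<open>m\<close>-th orbit point of 1/2. Hence at the \<open>i\<close>-th
    orbit point all terms with m \<ge> i count fully.\<close>
  define \<kappa> :: "nat \<Rightarrow> real \<Rightarrow> real"
    where "\<kappa> m y = max 0 (min 1 (min (2 * y) ((1 - y) * (1 + 2 ^ m))))" for m y
  define a where "a m = r m - r (Suc m)" for m
  have a0: "a m \<ge> 0" for m using r_dec[of m "Suc m"] by (simp add: a_def)
  have a_sums: "(\<lambda>m. a (m + k)) sums r k" for k
  proof -
    have "(\<lambda>m. r (m + k)) \<longlonglongrightarrow> 0" using r0 by (rule LIMSEQ_ignore_initial_segment)
    from telescope_sums'[OF this] show ?thesis by (simp add: a_def)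
  qed
  have \<kappa>01: "0 \<le> \<kappa> m y" "\<kappa> m y \<le> 1" for m y by (auto simp: \<kappa>_def)
  have b: "\<bar>a m * \<kappa> m y\<bar> \<le> a m" for m y
    using a0[of m] \<kappa>01[of m y] by (simp add: abs_mult mult_left_le)
  have sum_a: "summable a" using a_sums[of 0] by (simp add: sums_iff)
  have c: "continuous_on UNIV (\<lambda>y. a m * \<kappa> m y)" for m
    unfolding \<kappa>_def by (intro continuous_intros)
  define \<phi> where "\<phi> y = (\<Sum>m. a m * \<kappa> m y)" for y
  note ms = continuous_suminf[OF c b sum_a]
  have "\<phi> y = 0" if "y \<le> 0 \<or> y \<ge> 1" for y
  proof -
    have "\<kappa> m y = 0" for m
    proof (cases "y \<le> 0")
      case True
      then show ?thesis by (auto simp: \<kappa>_def)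
    next
      case False
      then have "(1 - y) * (1 + 2 ^ m) \<le> 0" using that by (intro mult_nonpos_nonneg) auto
      then show ?thesis by (auto simp: \<kappa>_def)
    qed
    then show ?thesis by (simp add: \<phi>_def)
  qed
  moreover have "continuous_on UNIV \<phi>" using ms(1) by (simp add: \<phi>_def[abs_def])
  moreover have "(\<Sum>i<n. \<phi> ((push ^^ i) (1/2))) \<ge> v n" if n: "n \<ge> 1" for n
  proof -
    have \<phi>_ge: "\<phi> ((push ^^ i) (1/2)) \<ge> r i" for i
    proof -
      define p where "p = (push ^^ i) (1/2 :: real)"
      have p: "p = 2 ^ i / (1 + 2 ^ i)"
      proof -
        have "p = 2 ^ i * (1/2) / (1 + (2 ^ i - 1) * (1/2))" unfolding p_def by (rule push_funpow) auto
        also have "\<dots> = 2 ^ i / (1 + 2 ^ i)" by (simp add: divide_simps add_pos_pos)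
        finally show ?thesis .
      qed
      have pos1: "1 + 2 ^ i > (0::real)" by (simp add: add_pos_pos)
      have "2 * p \<ge> 1" unfolding p using pos1 by (simp add: divide_simps)
      moreover have q: "1 - p = 1 / (1 + 2 ^ i)" unfolding p using pos1 by (simp add: divide_simps)
      have "(1 - p) * (1 + 2 ^ m) \<ge> 1" if "m \<ge> i" for m
        unfolding q using that pos1 by (simp add: pos_le_divide_eq)
      ultimately have \<kappa>1: "\<kappa> m p = 1" if "m \<ge> i" for m using that by (auto simp: \<kappa>_def)
      have "\<phi> p = (\<Sum>m. a (m + i) * \<kappa> (m + i) p) + (\<Sum>m<i. a m * \<kappa> m p)"
        unfolding \<phi>_def by (rule suminf_split_initial_segment) (rule ms(2))
      also have "(\<Sum>m. a (m + i) * \<kappa> (m + i) p) = r i"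
        using sums_unique[OF a_sums[of i]] by (simp add: \<kappa>1)
      finally show ?thesis
        using a0 \<kappa>01 by (simp add: p_def sum_nonneg)
    qed
    have "v n = real n * u (n - 1)" using n by (simp add: u_def)
    also have "\<dots> \<le> real n * r (n - 1)" using ur by (intro mult_left_mono) auto
    also have "\<dots> = (\<Sum>i<n. r (n - 1))" by simp
    also have "\<dots> \<le> (\<Sum>i<n. \<phi> ((push ^^ i) (1/2)))"
      by (intro sum_mono order_trans[OF r_dec \<phi>_ge]) auto
    finally show ?thesis .
  qed
  ultimately show ?thesis by blast
qed


section \<open>Skew products of the annulus\<close>

lemma supp_fun_bounded:
  assumes "supp_fun \<theta>"
  shows "\<exists>B. \<forall>y. \<bar>\<theta> y\<bar> \<le> B"
proof -
  have "compact (\<theta> ` {-3..4})"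
    using assms by (intro compact_continuous_image) (auto simp: supp_fun_def intro: continuous_on_subset)
  then obtain B where B: "\<forall>x\<in>\<theta> ` {-3..4}. norm x \<le> B" using compact_imp_bounded bounded_iff by metis
  have "\<bar>\<theta> y\<bar> \<le> max B 0" for y
  proof (cases "y \<in> {-3..4}")
    case True
    then have "\<bar>\<theta> y\<bar> \<le> B" using B by auto
    then show ?thesis by simp
  next
    case False
    then show ?thesis using assms by (auto simp: supp_fun_def)
  qed
  then show ?thesis by blast
qed

lemma supp_fun_continuous_on:
  "supp_fun \<theta> \<Longrightarrow> continuous_on S f \<Longrightarrow> continuous_on S (\<lambda>x. \<theta> (f x))"
  by (rule continuous_on_compose2[of UNIV \<theta>]) (auto simp: supp_fun_def)

lemma supp_homeo_continuous_on:
  "supp_homeo g \<Longrightarrow> continuous_on S f \<Longrightarrow> continuous_on S (\<lambda>x. g (f x))"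
  by (rule continuous_on_compose2[of UNIV g]) (auto simp: supp_homeo_continuous)

lemma supp_homeo_le_iff: "supp_homeo g \<Longrightarrow> g x \<le> g y \<longleftrightarrow> x \<le> y"
  by (simp add: supp_homeo_def strict_mono_less_eq)

lemma supp_homeo_interval:
  assumes "supp_homeo g" "a \<le> -3" "4 \<le> b" "a \<le> y" "y \<le> b"
  shows "a \<le> g y" "g y \<le> b"
  using supp_homeo_le_iff[OF assms(1), of a y] supp_homeo_le_iff[OF assms(1), of y b] assms
  by (auto simp: supp_homeo_def)

text \<open>The constant 7 is the length of [-3, 4], which is preserved.\<close>

lemma supp_homeo_dist_id:
  assumes "supp_homeo g"
  shows "\<bar>g y - y\<bar> \<le> 7"
proof (cases "-3 \<le> y \<and> y \<le> 4")
  case True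
  then show ?thesis using supp_homeo_interval[OF assms, of "-3" 4 y] by (simp add: abs_le_iff)
next
  case False
  then have "g y = y" using assms unfolding supp_homeo_def by (meson linear)
  then show ?thesis by simp
qed

definition interp :: "(real \<Rightarrow> real) \<Rightarrow> real \<Rightarrow> real \<Rightarrow> real" where
  "interp g t y = (1 - t) * y + t * g y"

text \<open>Increasing maps form a convex set, so the straight line from the identity to
  \<open>g\<close> is an isotopy.\<close>

lemma supp_homeo_interp:
  assumes g: "supp_homeo g" and t: "t \<in> {0..1}"
  shows "supp_homeo (interp g t)"
proof -
  have id: "g y = y" if "y \<le> -3 \<or> y \<ge> 4" for y
    using g that unfolding supp_homeo_def by blast
  have "supp_homeo (\<lambda>y. if -3 \<le> y \<and> y \<le> 4 then interp g t y else y)"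
  proof (rule supp_homeo_extend)
    show "continuous_on {-3..4} (interp g t)"
      unfolding interp_def
      by (intro continuous_intros continuous_on_subset[OF supp_homeo_continuous[OF g]]) auto
    show "interp g t x < interp g t y" if "x < y" for x y
    proof (cases "t = 0")
      case True
      then show ?thesis using that by (simp add: interp_def)
    next
      case False
      have "(1 - t) * x \<le> (1 - t) * y" using that t by (intro mult_left_mono) auto
      moreover have "t * g x < t * g y"
        using that t False g by (intro mult_strict_left_mono) (auto simp: supp_homeo_def strict_mono_less)
      ultimately show ?thesis by (simp add: interp_def)
    qed
  qed (auto simp: interp_def id algebra_simps)
  moreover have "(\<lambda>y. if -3 \<le> y \<and> y \<le> 4 then interp g t y else y) = interp g t"
  proof
    fix y
    show "(if -3 \<le> y \<and> y \<le> 4 then interp g t y else y) = interp g t y"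
      using id[of y] by (cases "-3 \<le> y \<and> y \<le> 4") (auto simp: interp_def algebra_simps)
  qed
  ultimately show ?thesis by simp
qed

text \<open>
  The affine change of variable \<open>y \<mapsto> 9 * y - 4\<close> carries \<open>[0, 1]\<close> to \<open>[-4, 5]\<close>, a neighbourhood of
  the interval \<open>[-3, 4]\<close> that contains the supports.
\<close>

definition skew :: "(real \<Rightarrow> real) \<Rightarrow> (real \<Rightarrow> real) \<Rightarrow> complex \<times> real \<Rightarrow> complex \<times> real" where
  "skew \<theta> g = (\<lambda>p\<in>annulus. (fst p * cis (2 * pi * \<theta> (9 * snd p - 4)), (g (9 * snd p - 4) + 4) / 9))"

lemma skew_in_annulus:
  assumes "supp_homeo g" "p \<in> annulus"
  shows "skew \<theta> g p \<in> annulus"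
  using supp_homeo_interval[OF assms(1), of "-4" 5 "9 * snd p - 4"] assms(2)
  by (auto simp: skew_def annulus_def norm_mult)

text \<open>The outer map reads its angle at the height already moved by \<open>g'\<close>, whence
  the cocycle form of the twist.\<close>

lemma compose_skew:
  assumes "supp_homeo g'"
  shows "compose annulus (skew \<theta> g) (skew \<theta>' g') = skew (\<lambda>y. \<theta>' y + \<theta> (g' y)) (g \<circ> g')"
proof
  fix p
  show "compose annulus (skew \<theta> g) (skew \<theta>' g') p = skew (\<lambda>y. \<theta>' y + \<theta> (g' y)) (g \<circ> g') p"
  proof (cases "p \<in> annulus")
    case True
    then have "skew \<theta>' g' p \<in> annulus" using assms by (intro skew_in_annulus)
    moreover have "9 * ((z + 4) / 9) - 4 = z" for z :: real by (simp add: field_simps)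
    ultimately show ?thesis
      using True by (simp add: compose_def skew_def cis_mult mult.assoc flip: distrib_left)
  next
    case False
    then show ?thesis by (simp add: compose_def skew_def)
  qed
qed

lemma skew_id: "skew (\<lambda>y. 0) id = (\<lambda>p\<in>annulus. p)"
  by (auto simp: skew_def fun_eq_iff)

lemma skew_inverse:
  assumes "supp_homeo g"
  defines "g' \<equiv> inv_into UNIV g"
  shows "compose annulus (skew \<theta> g) (skew (\<lambda>y. - \<theta> (g' y)) g') = (\<lambda>p\<in>annulus. p)"
    and "compose annulus (skew (\<lambda>y. - \<theta> (g' y)) g') (skew \<theta> g) = (\<lambda>p\<in>annulus. p)"
proof -
  have b: "bij g" using assms by (simp add: supp_homeo_bij)
  have g': "supp_homeo g'" unfolding g'_def by (rule supp_homeo_inv) fact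
  have 1: "g (g' y) = y" "g' (g y) = y" for y
    unfolding g'_def using b by (simp_all add: bij_is_surj surj_f_inv_f bij_is_inj inv_f_f)
  then have 2: "g \<circ> g' = id" "g' \<circ> g = id" by auto
  show "compose annulus (skew \<theta> g) (skew (\<lambda>y. - \<theta> (g' y)) g') = (\<lambda>p\<in>annulus. p)"
    unfolding compose_skew[OF g'] 2 by (simp add: skew_id)
  show "compose annulus (skew (\<lambda>y. - \<theta> (g' y)) g') (skew \<theta> g) = (\<lambda>p\<in>annulus. p)"
    unfolding compose_skew[OF assms(1)] 2 by (simp add: skew_id 1)
qed

lemma skew_inverse_apply:
  assumes "supp_homeo g" "p \<in> annulus"
  defines "g' \<equiv> inv_into UNIV g"
  shows "skew \<theta> g (skew (\<lambda>y. - \<theta> (g' y)) g' p) = p" "skew (\<lambda>y. - \<theta> (g' y)) g' (skew \<theta> g p) = p"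
  using skew_inverse[OF assms(1), of \<theta>, THEN fun_cong, of p] assms(2)
  by (simp_all add: compose_def g'_def)

lemma supp_fun_inverse:
  "supp_fun \<theta> \<Longrightarrow> supp_homeo g \<Longrightarrow> supp_fun (\<lambda>y. - \<theta> (inv_into UNIV g y))"
  by (rule supp_fun_minus, rule supp_fun_comp[OF _ supp_homeo_inv])

lemma skew_Bij:
  assumes "supp_homeo g"
  shows "skew \<theta> g \<in> Bij annulus"
proof -
  let ?h = "skew (\<lambda>y. - \<theta> (inv_into UNIV g y)) (inv_into UNIV g)"
  have "bij_betw (skew \<theta> g) annulus annulus"
  proof (rule bij_betw_byWitness[where f' = ?h])
    show "\<forall>a\<in>annulus. ?h (skew \<theta> g a) = a" "\<forall>a\<in>annulus. skew \<theta> g (?h a) = a"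
      using skew_inverse_apply[OF assms] by blast+
  qed (auto intro!: skew_in_annulus supp_homeo_inv assms)
  then show ?thesis by (auto simp: Bij_def skew_def)
qed

lemma continuous_on_skew:
  assumes "supp_fun \<theta>" "supp_homeo g"
  shows "continuous_on annulus (skew \<theta> g)"
proof -
  have "continuous_on annulus (\<lambda>p. \<theta> (9 * snd p - 4))" "continuous_on annulus (\<lambda>p. g (9 * snd p - 4))"
    by (intro supp_fun_continuous_on[OF assms(1)] supp_homeo_continuous_on[OF assms(2)] continuous_intros)+
  then have "continuous_on annulus (\<lambda>p. (fst p * cis (2 * pi * \<theta> (9 * snd p - 4)), (g (9 * snd p - 4) + 4) / 9))"
    by (intro continuous_intros) auto
  then show ?thesis by (simp add: skew_def cong: continuous_on_cong)
qed

lemma homeomorphic_map_skew: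
  assumes "supp_fun \<theta>" "supp_homeo g"
  shows "homeomorphic_map (top_of_set annulus) (top_of_set annulus) (skew \<theta> g)"
proof -
  let ?h = "skew (\<lambda>y. - \<theta> (inv_into UNIV g y)) (inv_into UNIV g)"
  note skew_inverse_apply[OF assms(2), of _ \<theta>]
  then have "homeomorphic_maps (top_of_set annulus) (top_of_set annulus) (skew \<theta> g) ?h"
    using assms unfolding homeomorphic_maps_def
    by (auto intro!: continuous_on_skew supp_fun_inverse supp_homeo_inv skew_in_annulus)
  then show ?thesis by (rule homeomorphic_maps_imp_map)
qed

lemma skew_annulus_homeos:
  assumes "supp_fun \<theta>" "supp_homeo g"
  shows "skew \<theta> g \<in> annulus_homeos"
proof -
  \<comment> \<open>The heights 1/9 and 8/9 correspond to -3 and 4 in the variable 9 y - 4.\<close>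
  define U where "U = annulus \<inter> {p. snd p < 1/9 \<or> snd p > 8/9}"
  have "open {p :: complex \<times> real. snd p < 1/9 \<or> snd p > 8/9}"
    by (intro open_Collect_disj open_Collect_less continuous_intros)
  then have "openin (top_of_set annulus) U" unfolding U_def by (rule openin_open_Int)
  moreover have "annulus_boundary \<subseteq> U"
    by (auto simp: U_def annulus_boundary_def annulus_def)
  moreover have "skew \<theta> g p = p" if "p \<in> U" for p
  proof -
    have "9 * snd p - 4 \<le> -3 \<or> 9 * snd p - 4 \<ge> 4" using that by (auto simp: U_def)
    then have "\<theta> (9 * snd p - 4) = 0" "g (9 * snd p - 4) = 9 * snd p - 4"
      using assms unfolding supp_fun_def supp_homeo_def by blast+
    then show ?thesis using that by (simp add: skew_def U_def)
  qed
  ultimately show ?thesis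
    using skew_Bij homeomorphic_map_skew assms unfolding annulus_homeos_def by blast
qed

section \<open>Isotopy to the identity: the identity component and the lift\<close>

lemma compact_annulus: "compact annulus"
  unfolding annulus_def by (intro compact_Times) auto

lemma skew_cfunspace:
  assumes "supp_fun \<theta>" "supp_homeo g"
  shows "skew \<theta> g \<in> mspace (cfunspace (top_of_set annulus) euclidean_metric)"
proof -
  have "bounded (skew \<theta> g ` annulus)"
    using compact_continuous_image[OF continuous_on_skew[OF assms] compact_annulus] by (rule compact_imp_bounded)
  then have "Metric_space.mbounded UNIV dist (skew \<theta> g ` annulus)" by simp
  then show ?thesis
    using continuous_on_skew[OF assms] by (simp add: skew_def)
qed

text \<open>The chord has length 2 |sin ((a - b)/2)|, which is at most the arc.\<close>

lemma dist_cis_le: "dist (cis a) (cis b) \<le> \<bar>a - b\<bar>"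
proof -
  have "(dist (cis a) (cis b))\<^sup>2 = (cos a - cos b)\<^sup>2 + (sin a - sin b)\<^sup>2"
    by (simp add: dist_norm cmod_power2)
  also have "\<dots> = 2 - 2 * cos (a - b)"
    using sin_cos_squared_add[of a] sin_cos_squared_add[of b]
    by (simp add: cos_diff power2_eq_square algebra_simps)
  also have "\<dots> = (2 * \<bar>sin ((a - b) / 2)\<bar>)\<^sup>2"
  proof -
    have "2 * ((a - b) / 2) = a - b" by simp
    then show ?thesis using cos_double_sin[of "(a - b) / 2"] by (simp only: power_mult_distrib power2_abs) simp
  qed
  also have "\<dots> \<le> (2 * \<bar>(a - b) / 2\<bar>)\<^sup>2"
    by (intro power_mono mult_left_mono abs_sin_x_le_abs_x) auto
  also have "\<dots> = \<bar>a - b\<bar>\<^sup>2" by simp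
  finally show ?thesis by (rule power2_le_imp_le) simp
qed

text \<open>Scaling the twist by \<open>t\<close> and interpolating the height map gives a path from
  the identity that is Lipschitz for the uniform distance; its image is connected.\<close>

lemma skew_in_carrier:
  assumes \<theta>: "supp_fun \<theta>" and g: "supp_homeo g"
  shows "skew \<theta> g \<in> carrier Homeo0_annulus"
proof -
  let ?M = "cfunspace (top_of_set annulus) (euclidean_metric :: (complex \<times> real) metric)"
  define k where "k t = skew (\<lambda>y. t * \<theta> y) (interp g t)" for t
  obtain B where B: "\<And>y. \<bar>\<theta> y\<bar> \<le> B" using supp_fun_bounded[OF \<theta>] by blast
  have B0: "B \<ge> 0" using B[of 0] by simp
  have k: "k t \<in> mspace ?M" "k t \<in> annulus_homeos" if "t \<in> {0..1}" for t
    unfolding k_def using that \<theta> g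
    by (auto intro!: skew_cfunspace skew_annulus_homeos supp_fun_scale supp_homeo_interp simp del: mspace_cfunspace)
  have "mdist ?M (k s) (k t) \<le> (2 * pi * B + 1) * dist s t" if "s \<in> {0..1}" "t \<in> {0..1}" for s t
  proof (rule mdist_cfunspace_le)
    show "0 \<le> (2 * pi * B + 1) * dist s t" using B0 by simp
    fix p assume "p \<in> topspace (top_of_set annulus)"
    then have p: "p \<in> annulus" "norm (fst p) = 1" by (auto simp: annulus_def)
    define y where "y = 9 * snd p - 4"
    have "dist (fst (k s p)) (fst (k t p)) = dist (cis (2 * pi * (s * \<theta> y))) (cis (2 * pi * (t * \<theta> y)))"
      using p by (simp add: k_def skew_def y_def dist_norm norm_mult flip: right_diff_distrib)
    also have "\<dots> \<le> \<bar>2 * pi * (s * \<theta> y) - 2 * pi * (t * \<theta> y)\<bar>" by (rule dist_cis_le)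
    also have "\<dots> = 2 * pi * (\<bar>\<theta> y\<bar> * dist s t)"
      by (simp add: dist_real_def abs_mult flip: right_diff_distrib left_diff_distrib)
    also have "\<dots> \<le> 2 * pi * (B * dist s t)"
      using B by (intro mult_left_mono mult_right_mono) auto
    finally have 1: "dist (fst (k s p)) (fst (k t p)) \<le> 2 * pi * B * dist s t" by simp
    have "snd (k s p) - snd (k t p) = (s - t) * ((g y - y) / 9)"
      using p(1) by (simp add: k_def skew_def y_def interp_def field_simps)
    then have "dist (snd (k s p)) (snd (k t p)) = dist s t * (\<bar>g y - y\<bar> / 9)"
      by (simp only: dist_real_def abs_mult abs_divide abs_numeral)
    also have "\<dots> \<le> dist s t * 1"
      using supp_homeo_dist_id[OF g, of y] by (intro mult_left_mono) auto
    finally have 2: "dist (snd (k s p)) (snd (k t p)) \<le> dist s t" by simp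
    have "dist (k s p) (k t p) \<le> dist (fst (k s p)) (fst (k t p)) + dist (snd (k s p)) (snd (k t p))"
      unfolding dist_prod_def by (rule sqrt_sum_squares_le_sum) auto
    then show "mdist euclidean_metric (k s p) (k t p) \<le> (2 * pi * B + 1) * dist s t"
      using 1 2 by (simp add: algebra_simps)
  qed
  then have "Lipschitz_continuous_map (submetric euclidean_metric {0..1}) ?M k"
    unfolding Lipschitz_continuous_map_def using k(1)
    by (auto simp del: mspace_cfunspace intro!: exI[of _ "2 * pi * B + 1"])
  then have "continuous_map (top_of_set {0..1}) (mtopology_of ?M) k"
    using Lipschitz_continuous_imp_continuous_map[of _ ?M k] by (fastforce simp: mtopology_of_submetric)
  then have "continuous_map (top_of_set {0..1}) annulus_homeos_topology k"
    unfolding annulus_homeos_topology_def using k(2)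
    by (intro continuous_map_into_subtopology) auto
  then have "connectedin annulus_homeos_topology (k ` {0..1})"
    by (rule connectedin_continuous_map_image) (simp add: connectedin_subtopology)
  moreover have "k 0 = (\<lambda>z\<in>annulus. z)"
    unfolding k_def interp_def by (simp add: skew_id flip: id_def)
  moreover have "k 1 = skew \<theta> g"
    unfolding k_def interp_def by simp
  moreover have "k 0 \<in> k ` {0..1}" "k 1 \<in> k ` {0..1}" by (intro imageI; simp)+
  ultimately show ?thesis
    unfolding Homeo0_annulus_def connected_component_of_def by (auto intro!: exI[of _ "k ` {0..1}"])
qed

text \<open>The same isotopy lifts explicitly: the rotation by the angle t \<theta> becomes the
  translation by t \<theta>.\<close>

lemma is_isotopy_lift_skew:
  assumes \<theta>: "supp_fun \<theta>" and g: "supp_homeo g"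
  shows "is_isotopy_lift (skew \<theta> g) (\<lambda>(x, y). (x + \<theta> (9 * y - 4), (g (9 * y - 4) + 4) / 9))"
proof -
  define h where "h = (\<lambda>(t, p). skew (\<lambda>y. t * \<theta> y) (interp g t) p)"
  define H where "H = (\<lambda>(t :: real, x, y). (x + t * \<theta> (9 * y - 4), (interp g t (9 * y - 4) + 4) / 9))"
  have T: "continuous_on S (\<lambda>q. \<theta> (f q))" "continuous_on S (\<lambda>q. g (f q))"
    if "continuous_on S f" for S and f :: "'a :: topological_space \<Rightarrow> real"
    by (rule supp_fun_continuous_on[OF \<theta> that], rule supp_homeo_continuous_on[OF g that])
  have "continuous_on ({0..1} \<times> annulus) (\<lambda>q. (fst (snd q) * cis (2 * pi * (fst q * \<theta> (9 * snd (snd q) - 4))),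
       (interp g (fst q) (9 * snd (snd q) - 4) + 4) / 9))"
    unfolding interp_def by (intro continuous_intros T) auto
  then have h_cont: "continuous_on ({0..1} \<times> annulus) h"
    by (rule continuous_on_eq) (auto simp: h_def skew_def)
  have hom: "homeomorphic_map (top_of_set annulus) (top_of_set annulus) (\<lambda>z. h (t, z))" if "t \<in> {0..1}" for t
    using homeomorphic_map_skew[OF supp_fun_scale[OF \<theta>] supp_homeo_interp[OF g that]] by (simp add: h_def)
  have "h (t, z) = z" if "t \<in> {0..1}" "z \<in> annulus_boundary" for t z
  proof -
    have z: "z \<in> annulus" "snd z = 0 \<or> snd z = 1" using that(2) by (auto simp: annulus_boundary_def annulus_def)
    then have "9 * snd z - 4 \<le> -3 \<or> 9 * snd z - 4 \<ge> 4" by auto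
    then have "\<theta> (9 * snd z - 4) = 0" "interp g t (9 * snd z - 4) = 9 * snd z - 4"
      using \<theta> supp_homeo_interp[OF g that(1)] unfolding supp_fun_def supp_homeo_def by blast+
    then show ?thesis using z by (simp add: h_def skew_def)
  qed
  moreover have "h (0, z) = z" "h (1, z) = skew \<theta> g z" if "z \<in> annulus" for z
    using that by (simp_all add: h_def skew_def interp_def)
  ultimately have iso: "isotopy_rel_boundary h (skew \<theta> g)"
    using h_cont hom by (simp add: isotopy_rel_boundary_def)
  have "continuous_on ({0..1} \<times> strip) H"
    unfolding H_def interp_def case_prod_unfold by (intro continuous_intros T) auto
  moreover have "H (t, p) \<in> strip" if "t \<in> {0..1}" "p \<in> strip" for t p
    using supp_homeo_interval[OF supp_homeo_interp[OF g that(1)], of "-4" 5 "9 * snd p - 4"] that(2)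
    by (auto simp: H_def strip_def)
  moreover have "annulus_cover (H (t, p)) = h (t, annulus_cover p)" if "p \<in> strip" for t p
    using that by (auto simp: annulus_cover_def H_def h_def skew_def strip_def annulus_def cis_mult algebra_simps)
  moreover have "H (0, p) = p" for p
    by (simp add: H_def interp_def case_prod_unfold)
  ultimately have "lifts_isotopy H h" by (simp add: lifts_isotopy_def)
  with iso show ?thesis
    unfolding is_isotopy_lift_def by (intro exI[of _ h] exI[of _ H]) (auto simp: H_def interp_def)
qed


section \<open>The distorted skew product\<close>

interpretation annulus: group "BijGroup annulus"
  by (rule group_BijGroup)

lemma carrier_BijGroup: "carrier (BijGroup S) = Bij S"
  by (simp add: BijGroup_def)

lemma skew_mult:
  assumes "supp_homeo g" "supp_homeo g'"
  shows "skew \<theta> g \<otimes>\<^bsub>BijGroup annulus\<^esub> skew \<theta>' g' = skew (\<lambda>y. \<theta>' y + \<theta> (g' y)) (g \<circ> g')"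
  using compose_skew[OF assms(2)] skew_Bij assms by (simp add: BijGroup_def)

lemma skew_one: "\<one>\<^bsub>BijGroup annulus\<^esub> = skew (\<lambda>y. 0) id"
  by (simp add: BijGroup_def skew_id)

lemma skew_inv:
  assumes "supp_homeo g"
  shows "inv\<^bsub>BijGroup annulus\<^esub> (skew \<theta> g) = skew (\<lambda>y. - \<theta> (inv_into UNIV g y)) (inv_into UNIV g)"
proof (rule annulus.inv_equality)
  have g': "supp_homeo (inv_into UNIV g)" using assms by (rule supp_homeo_inv)
  show "skew \<theta> g \<in> carrier (BijGroup annulus)"
    "skew (\<lambda>y. - \<theta> (inv_into UNIV g y)) (inv_into UNIV g) \<in> carrier (BijGroup annulus)"
    using assms g' by (auto simp: carrier_BijGroup skew_Bij)
  show "skew (\<lambda>y. - \<theta> (inv_into UNIV g y)) (inv_into UNIV g) \<otimes>\<^bsub>BijGroup annulus\<^esub> skew \<theta> g = \<one>\<^bsub>BijGroup annulus\<^esub>"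
    using skew_inverse(2)[OF assms] skew_Bij assms g' by (simp add: BijGroup_def)
qed

text \<open>Confines the subgroup generated by skew products to skew products, hence to the identity
  component, without showing that the component itself is a group.\<close>

lemma subgroup_skew: "subgroup {skew \<theta> g | \<theta> g. supp_fun \<theta> \<and> supp_homeo g} (BijGroup annulus)" (is "subgroup ?K _")
proof (rule annulus.subgroupI)
  show "?K \<subseteq> carrier (BijGroup annulus)" by (auto simp: carrier_BijGroup skew_Bij)
  show "?K \<noteq> {}" using supp_fun_zero supp_homeo_id by blast
  show "inv\<^bsub>BijGroup annulus\<^esub> a \<in> ?K" if "a \<in> ?K" for a
  proof -
    from that obtain \<theta> g where *: "a = skew \<theta> g" "supp_fun \<theta>" "supp_homeo g" by blast
    then show ?thesis
      using skew_inv[of g \<theta>] supp_fun_inverse[of \<theta> g] supp_homeo_inv[of g] by blast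
  qed
  show "a \<otimes>\<^bsub>BijGroup annulus\<^esub> b \<in> ?K" if "a \<in> ?K" "b \<in> ?K" for a b
  proof -
    from that obtain \<theta> g \<theta>' g' where *: "a = skew \<theta> g" "b = skew \<theta>' g'" "supp_fun \<theta>" "supp_homeo g"
      "supp_fun \<theta>'" "supp_homeo g'" by blast
    have "a \<otimes>\<^bsub>BijGroup annulus\<^esub> b = skew (\<lambda>y. \<theta>' y + \<theta> (g' y)) (g \<circ> g')"
      using * by (simp add: skew_mult)
    moreover have "supp_fun (\<lambda>y. \<theta>' y + \<theta> (g' y))"
      using * by (intro supp_fun_add supp_fun_comp[of \<theta> g'])
    ultimately show ?thesis using supp_homeo_comp[of g g'] * by blast
  qed
qed

lemma skew_pow:
  assumes "supp_homeo g"
  shows "skew \<theta> g [^]\<^bsub>BijGroup annulus\<^esub> (n::nat) = skew (\<lambda>y. \<Sum>i<n. \<theta> ((g ^^ i) y)) (g ^^ n)"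
proof (induction n)
  case 0
  then show ?case by (simp add: skew_one flip: id_def)
next
  case (Suc n)
  have "skew \<theta> g [^]\<^bsub>BijGroup annulus\<^esub> (Suc n) =
      skew \<theta> g \<otimes>\<^bsub>BijGroup annulus\<^esub> skew \<theta> g [^]\<^bsub>BijGroup annulus\<^esub> n"
    using skew_Bij[OF assms, of \<theta>] by (intro annulus.nat_pow_Suc2) (simp add: carrier_BijGroup)
  then show ?case
    using Suc skew_mult[OF assms supp_homeo_funpow[OF assms]] by (simp add: comp_def)
qed

text \<open>Conjugation precomposes a twist with a height map; this is how the functions read from
  \<open>\<Theta>\<close> become words.\<close>

lemma skew_conj:
  assumes "supp_homeo g"
  shows "inv\<^bsub>BijGroup annulus\<^esub> (skew (\<lambda>y. 0) g) \<otimes>\<^bsub>BijGroup annulus\<^esub>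
      (skew \<theta> id \<otimes>\<^bsub>BijGroup annulus\<^esub> skew (\<lambda>y. 0) g) = skew (\<lambda>y. \<theta> (g y)) id"
proof -
  have "inv_into UNIV g \<circ> g = id"
    using supp_homeo_bij[OF assms] by (simp add: bij_is_inj)
  then show ?thesis
    using assms by (simp add: skew_inv skew_mult supp_homeo_id supp_homeo_inv)
qed

text \<open>Conjugating by \<open>shift ^^ k\<close> costs 2k + 1 letters. Two such factors, and two
  more conjugated by an expanding map, add up to 2 (2k + 1) + 2 (2k + 3) letters.\<close>

lemma word_in_twist:
  assumes S: "S \<subseteq> carrier (BijGroup annulus)"
    and gens: "skew \<Theta> id \<in> S" "skew (\<lambda>y. 0) shift \<in> S"
      "skew (\<lambda>y. 0) left_expand \<in> S" "skew (\<lambda>y. 0) right_expand \<in> S"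
  shows "word_in (BijGroup annulus) S (8 * k + 8) (skew (\<lambda>y. 2 * \<Theta> ((shift ^^ k) y)
     - \<Theta> ((shift ^^ k) (left_expand y)) - \<Theta> ((shift ^^ k) (right_expand y))) id)"
proof -
  let ?G = "BijGroup annulus"
  define A where "A y = \<Theta> ((shift ^^ k) y)" for y
  note mult = annulus.word_in_mult[OF S] and gen = annulus.word_in_gen[OF S]
  have "skew (\<lambda>y. 0) (shift ^^ k) = skew (\<lambda>y. 0) shift [^]\<^bsub>?G\<^esub> k"
    by (simp add: skew_pow supp_homeo_shift)
  then have "word_in ?G S k (skew (\<lambda>y. 0) (shift ^^ k))"
    using annulus.word_in_pow[OF S gen[OF gens(2)], of k] by simp
  from annulus.word_in_conj[OF S this gen[OF gens(1)]]
  have A: "word_in ?G S (2 * k + 1) (skew A id)"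
    by (simp add: skew_conj supp_homeo_funpow supp_homeo_shift A_def[abs_def])
  have mA: "word_in ?G S (2 * k + 1) (skew (\<lambda>y. - A y) id)"
    using annulus.word_in_inv[OF S A] by (simp add: skew_inv supp_homeo_id inv_id[unfolded id_def] flip: id_def)
  have L: "word_in ?G S (2 * 1 + (2 * k + 1)) (skew (\<lambda>y. - A (left_expand y)) id)"
    using annulus.word_in_conj[OF S gen[OF gens(3)] mA] by (simp add: skew_conj supp_homeo_left_expand)
  have R: "word_in ?G S (2 * 1 + (2 * k + 1)) (skew (\<lambda>y. - A (right_expand y)) id)"
    using annulus.word_in_conj[OF S gen[OF gens(4)] mA] by (simp add: skew_conj supp_homeo_right_expand)
  have "skew A id \<otimes>\<^bsub>?G\<^esub> (skew A id \<otimes>\<^bsub>?G\<^esub>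
      (skew (\<lambda>y. - A (left_expand y)) id \<otimes>\<^bsub>?G\<^esub> skew (\<lambda>y. - A (right_expand y)) id))
    = skew (\<lambda>y. 2 * A y - A (left_expand y) - A (right_expand y)) id"
    by (simp add: skew_mult supp_homeo_id algebra_simps)
  moreover have "2 * k + 1 + (2 * k + 1 + (2 * 1 + (2 * k + 1) + (2 * 1 + (2 * k + 1)))) = 8 * k + 8"
    by simp
  ultimately show ?thesis
    using mult[OF A mult[OF A mult[OF L R]]] by (simp only: A_def)
qed

lemma word_in_push_pow:
  assumes S: "S \<subseteq> carrier (BijGroup annulus)"
    and gens: "skew (\<lambda>y. 0) push \<in> S" "skew (\<lambda>y. 0) odds_square \<in> S"
  shows "word_in (BijGroup annulus) S (2 * m + 1) (skew (\<lambda>y. 0) (push ^^ (2 ^ m)))"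
proof -
  let ?G = "BijGroup annulus" and ?h = "odds_square ^^ m"
  have h: "supp_homeo ?h" by (intro supp_homeo_funpow supp_homeo_odds_square)
  have "skew (\<lambda>y. 0) ?h = skew (\<lambda>y. 0) odds_square [^]\<^bsub>?G\<^esub> m"
    by (simp add: skew_pow supp_homeo_odds_square)
  then have hw: "word_in ?G S m (skew (\<lambda>y. 0) ?h)"
    using annulus.word_in_pow[OF S annulus.word_in_gen[OF S gens(2)], of m] by simp
  have "?h \<circ> (push \<circ> inv_into UNIV ?h) = push ^^ (2 ^ m)"
    using supp_homeo_bij[OF h] by (simp add: fun_eq_iff odds_square_push_funpow bij_is_surj surj_f_inv_f)
  then have "skew (\<lambda>y. 0) ?h \<otimes>\<^bsub>?G\<^esub> (skew (\<lambda>y. 0) push \<otimes>\<^bsub>?G\<^esub> inv\<^bsub>?G\<^esub> skew (\<lambda>y. 0) ?h) = skew (\<lambda>y. 0) (push ^^ (2 ^ m))"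
    using h by (simp add: skew_inv skew_mult supp_homeo_push supp_homeo_inv supp_homeo_comp)
  then show ?thesis
    using annulus.word_in_mult[OF S hw annulus.word_in_mult[OF S annulus.word_in_gen[OF S gens(1)] annulus.word_in_inv[OF S hw]]]
    by (simp add: mult_2)
qed

text \<open>Balances two demands on \<open>Q\<close>: large enough to shrink the Birkhoff sum below
  (1/2)^k, yet small enough that \<open>Q\<close> words of length 8k + 8 remain a small fraction of
  2^m.\<close>

lemma ex_short_powers:
  fixes s :: "nat \<Rightarrow> real \<Rightarrow> real"
  assumes small: "\<And>e. e > 0 \<Longrightarrow> \<exists>N. \<forall>n\<ge>N. \<forall>y. \<bar>s n y\<bar> \<le> e * real n"
  shows "\<exists>m Q. Q \<ge> (1::nat) \<and> (\<forall>y. \<bar>s (2 ^ m) y / real Q\<bar> \<le> (1/2) ^ k) \<and>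
     real (2 * m + 1 + Q * (8 * k + 8)) \<le> 2 / real (k + 1) * 2 ^ m"
proof -
  define c where "c = real (8 * k + 8)"
  have c: "c > 0" by (simp add: c_def)
  \<comment> \<open>Chosen so that \<open>q * c\<close> below is exactly 2^m / (k + 1).\<close>
  define e where "e = 1 / (2 ^ k * c * real (k + 1))"
  have e: "e > 0" using c by (simp add: e_def)
  obtain N where N: "\<And>n y. n \<ge> N \<Longrightarrow> \<bar>s n y\<bar> \<le> e * real n" using small[OF e] by blast
  \<comment> \<open>A second share 2^m / (k + 1) pays for rounding \<open>q\<close> up, at cost
    \<open>c\<close>, and for the 2m + 1 letters of the power of \<open>push\<close>.\<close>
  have "eventually (\<lambda>m. (c + 2 * real m + 1) * real (k + 1) \<le> 2 ^ m) sequentially" by real_asymp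
  moreover have "eventually (\<lambda>m. real N \<le> 2 ^ m) sequentially" by real_asymp
  ultimately have "eventually (\<lambda>m. (c + 2 * real m + 1) * real (k + 1) \<le> 2 ^ m \<and> real N \<le> 2 ^ m) sequentially"
    by eventually_elim simp
  then obtain m where m: "(c + 2 * real m + 1) * real (k + 1) \<le> 2 ^ m" "real N \<le> 2 ^ m"
    by (auto simp: eventually_sequentially)
  define q where "q = 2 ^ k * e * 2 ^ m"
  have q: "q > 0" using e by (simp add: q_def)
  define Q where "Q = nat \<lceil>q\<rceil>"
  have Q: "Q \<ge> 1" "q \<le> real Q" "real Q \<le> q + 1" using q by (auto simp: Q_def) linarith+
  have "\<bar>s (2 ^ m) y / real Q\<bar> \<le> (1/2) ^ k" for y
  proof -
    have "N \<le> 2 ^ m" using m(2) by (metis of_nat_le_iff of_nat_numeral of_nat_power)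
    then have "\<bar>s (2 ^ m) y\<bar> \<le> e * 2 ^ m" using N[of "2 ^ m" y] by simp
    also have "\<dots> = (1/2) ^ k * q" by (simp add: q_def power_one_over)
    also have "\<dots> \<le> (1/2) ^ k * real Q" using Q by (intro mult_left_mono) auto
    finally show ?thesis using Q by (simp add: pos_divide_le_eq)
  qed
  moreover have "real (2 * m + 1 + Q * (8 * k + 8)) \<le> 2 / real (k + 1) * 2 ^ m"
  proof -
    have "real Q * c \<le> (q + 1) * c" using Q c by (intro mult_right_mono) auto
    also have "q * c = 2 ^ m / real (k + 1)" using c by (simp add: q_def e_def)
    then have "(q + 1) * c = 2 ^ m / real (k + 1) + c" by (simp add: algebra_simps)
    finally have "real Q * c \<le> 2 ^ m / real (k + 1) + c" .
    moreover have "c + 2 * real m + 1 \<le> 2 ^ m / real (k + 1)"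
      using m(1) by (subst pos_le_divide_eq) auto
    ultimately have "real Q * c + (2 * real m + 1) \<le> 2 / real (k + 1) * 2 ^ m" by simp
    then show ?thesis by (simp add: c_def algebra_simps)
  qed
  ultimately show ?thesis using Q(1) by blast
qed

lemma lift_funpow:
  fixes \<phi> g :: "real \<Rightarrow> real"
  shows "((\<lambda>(x, y). (x + \<phi> (9 * y - 4), (g (9 * y - 4) + 4) / 9)) ^^ n) (x, y) =
    (x + (\<Sum>i<n. \<phi> ((g ^^ i) (9 * y - 4))), ((g ^^ n) (9 * y - 4) + 4) / 9)"
proof (induction n)
  case (Suc n)
  have "9 * ((z + 4) / 9) - 4 = z" for z :: real by (simp add: field_simps)
  then show ?case using Suc by simp
qed simp

theorem theorem2p6:
  fixes v :: "nat \<Rightarrow> real"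
  assumes "\<And>n. n \<ge> 1 \<Longrightarrow> v n > 0"
    and "(\<lambda>n. v n / real n) \<longlonglongrightarrow> 0"
  shows "\<exists>f F. f \<in> carrier Homeo0_annulus \<and> is_isotopy_lift f F \<and>
           (\<forall>n\<ge>1. diameter ((F ^^ n) ` ({0..1} \<times> {0..1})) \<ge> v n) \<and>
           distortion_element Homeo0_annulus f"
proof -
  obtain \<phi> where cont: "continuous_on UNIV \<phi>" and supp: "\<And>y. y \<le> 0 \<or> y \<ge> 1 \<Longrightarrow> \<phi> y = 0"
    and large: "\<And>n. n \<ge> 1 \<Longrightarrow> (\<Sum>i<n. \<phi> ((push ^^ i) (1/2))) \<ge> v n"
    using ex_birkhoff_sum_ge[OF assms(2,1)] by blast
  have \<phi>: "supp_fun \<phi>" unfolding supp_fun_def using cont supp by auto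
  let ?G = "BijGroup annulus"
  define f where "f = skew \<phi> push"
  define F where "F = (\<lambda>(x, y). (x + \<phi> (9 * y - 4), (push (9 * y - 4) + 4) / 9))"
  have "diameter ((F ^^ n) ` ({0..1} \<times> {0..1})) \<ge> v n" if "n \<ge> 1" for n
  proof -
    have F_cont: "continuous_on UNIV F"
      unfolding F_def case_prod_unfold
      by (intro continuous_intros supp_fun_continuous_on[OF \<phi>] supp_homeo_continuous_on[OF supp_homeo_push]) auto
    have "continuous_on UNIV (F ^^ n)"
    proof (induction n)
      case (Suc n)
      then show ?case
        using continuous_on_compose[OF Suc continuous_on_subset[OF F_cont]] by simp
    qed (simp add: id_def)
    then have "compact ((F ^^ n) ` ({0..1} \<times> {0..1}))"
      by (intro compact_continuous_image compact_Times) (auto intro: continuous_on_subset)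
    then have bdd: "bounded ((F ^^ n) ` ({0..1} \<times> {0..1}))" by (rule compact_imp_bounded)
    \<comment> \<open>Height 0 is -4 in the inner variable, where nothing moves, while height 1/2 is
      the point 1/2 whose Birkhoff sums are large; the horizontal gap between the two images bounds
      the diameter.\<close>
    have id: "(push ^^ i) (-4) = -4" for i by (induction i) (auto simp: push_def)
    have a: "fst ((F ^^ n) (0, 0)) = 0"
      using supp[of "-4"] by (simp add: F_def lift_funpow id)
    have b: "fst ((F ^^ n) (0, 1/2)) = (\<Sum>i<n. \<phi> ((push ^^ i) (1/2)))"
      by (simp add: F_def lift_funpow)
    have "v n \<le> \<bar>fst ((F ^^ n) (0, 1/2)) - fst ((F ^^ n) (0, 0))\<bar>"
      using large[OF that] unfolding a b by simp
    also have "\<dots> \<le> dist ((F ^^ n) (0, 1/2)) ((F ^^ n) (0, 0))"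
      using dist_fst_le[of "(F ^^ n) (0, 1/2)" "(F ^^ n) (0, 0)"] by (simp add: dist_real_def)
    also have "\<dots> \<le> diameter ((F ^^ n) ` ({0..1} \<times> {0..1}))"
      using bdd by (intro diameter_bounded_bound) auto
    finally show ?thesis .
  qed
  moreover have "is_isotopy_lift f F"
    unfolding f_def F_def by (rule is_isotopy_lift_skew[OF \<phi> supp_homeo_push])
  moreover have "f \<in> carrier Homeo0_annulus"
    unfolding f_def by (rule skew_in_carrier[OF \<phi> supp_homeo_push])
  moreover have "distortion_element Homeo0_annulus f"
  proof -
    define s where "s n y = (\<Sum>i<n. \<phi> ((push ^^ i) y))" for n y
    have s_fun: "supp_fun (s n)" for n
      unfolding s_def[abs_def]
      by (intro supp_fun_sum supp_fun_comp[OF \<phi> supp_homeo_funpow[OF supp_homeo_push]])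
    have s_supp: "s n y = 0" if "y \<le> 0 \<or> y \<ge> 1" for n y
    proof -
      have "push y = y" using that by (auto simp: push_def)
      then have "(push ^^ i) y = y" for i by (induction i) auto
      then show ?thesis using supp[OF that] by (simp add: s_def)
    qed
    have "\<exists>N. \<forall>n\<ge>N. \<forall>y. \<bar>s n y\<bar> \<le> e * real n" if "e > 0" for e
      unfolding s_def using birkhoff_sum_sublinear[OF cont supp that] by blast
    then have "\<forall>k. \<exists>m Q. Q \<ge> (1::nat) \<and> (\<forall>y. \<bar>s (2 ^ m) y / real Q\<bar> \<le> (1/2) ^ k) \<and>
        real (2 * m + 1 + Q * (8 * k + 8)) \<le> 2 / real (k + 1) * 2 ^ m"
      using ex_short_powers[of s] by blast
    then obtain m Q where Q: "\<And>k. Q k \<ge> (1::nat)"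
      and bound: "\<And>k y. \<bar>s (2 ^ m k) y / real (Q k)\<bar> \<le> (1/2) ^ k"
      and short: "\<And>k. real (2 * m k + 1 + Q k * (8 * k + 8)) \<le> 2 / real (k + 1) * 2 ^ m k"
      by metis
    \<comment> \<open>The sequence to be stored: the \<open>Q k\<close>-th power of the twist by
      \<open>\<eta> k\<close> is the twist by the full Birkhoff sum.\<close>
    define \<eta> where "\<eta> k y = s (2 ^ m k) y / real (Q k)" for k y
    have "continuous_on UNIV (\<eta> k)" for k
      using s_fun[of "2 ^ m k"] unfolding \<eta>_def[abs_def] supp_fun_def
      by (intro continuous_on_divide continuous_on_const) (use Q[of k] in auto)
    then obtain \<Theta> where \<Theta>: "supp_fun \<Theta>"
      and \<eta>: "\<And>k y. \<eta> k y = 2 * \<Theta> ((shift ^^ k) y)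
         - \<Theta> ((shift ^^ k) (left_expand y)) - \<Theta> ((shift ^^ k) (right_expand y))"
      using universal_twist[of \<eta>] s_supp bound by (auto simp: \<eta>_def)
    define S where "S = {f, skew \<Theta> id, skew (\<lambda>y. 0) shift, skew (\<lambda>y. 0) left_expand,
      skew (\<lambda>y. 0) right_expand, skew (\<lambda>y. 0) push, skew (\<lambda>y. 0) odds_square}"
    let ?K = "{skew \<theta> g | \<theta> g. supp_fun \<theta> \<and> supp_homeo g}"
    have SK: "S \<subseteq> ?K"
      unfolding S_def f_def
      using \<phi> \<Theta> supp_fun_zero supp_homeo_id supp_homeo_shift supp_homeo_left_expand
        supp_homeo_right_expand supp_homeo_push supp_homeo_odds_square by blast
    have S: "S \<subseteq> carrier ?G" using SK subgroup.subset[OF subgroup_skew] by blast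
    have gen: "generate ?G S \<subseteq> carrier Homeo0_annulus"
      using annulus.generate_subgroup_incl[OF SK subgroup_skew] skew_in_carrier by blast
    have carrier: "carrier Homeo0_annulus \<subseteq> carrier ?G"
    proof -
      have "carrier Homeo0_annulus \<subseteq> topspace annulus_homeos_topology"
        by (simp add: Homeo0_annulus_def connected_component_of_subset_topspace)
      also have "\<dots> \<subseteq> annulus_homeos" by (simp add: annulus_homeos_topology_def)
      finally show ?thesis by (auto simp: annulus_homeos_def carrier_BijGroup)
    qed
    have word: "word_in ?G S (2 * m k + 1 + Q k * (8 * k + 8)) (f [^]\<^bsub>?G\<^esub> (2 ^ m k :: nat))" for k
    proof -
      have "word_in ?G S (8 * k + 8) (skew (\<eta> k) id)"
        unfolding \<eta>[abs_def] by (rule word_in_twist[OF S]) (auto simp: S_def)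
      from annulus.word_in_pow[OF S this, of "Q k"]
      have "word_in ?G S (Q k * (8 * k + 8)) (skew (s (2 ^ m k)) id)"
        using Q[of k] by (simp add: skew_pow supp_homeo_id \<eta>_def)
      moreover have "word_in ?G S (2 * m k + 1) (skew (\<lambda>y. 0) (push ^^ (2 ^ m k)))"
        by (rule word_in_push_pow[OF S]) (auto simp: S_def)
      \<comment> \<open>The right factor acts first: twist by the Birkhoff sum, then push the
        heights.\<close>
      moreover have "f [^]\<^bsub>?G\<^esub> (2 ^ m k :: nat) =
          skew (\<lambda>y. 0) (push ^^ (2 ^ m k)) \<otimes>\<^bsub>?G\<^esub> skew (s (2 ^ m k)) id"
        by (simp add: f_def skew_pow skew_mult supp_homeo_push supp_homeo_funpow supp_homeo_id s_def[abs_def])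
      ultimately show ?thesis using annulus.word_in_mult[OF S] by metis
    qed
    have "distortion_element (?G\<lparr>carrier := carrier Homeo0_annulus\<rparr>) f"
    proof (rule annulus.distortion_element_carrier_update[OF _ S _ gen carrier])
      fix e :: real assume "e > 0"
      then obtain k :: nat where k: "real k > 2 / e" using reals_Archimedean2 by blast
      have "2 / real (k + 1) \<le> e"
        using k \<open>e > 0\<close> by (simp add: field_simps)
      then have "2 / real (k + 1) * 2 ^ m k \<le> e * 2 ^ m k" by (intro mult_right_mono) auto
      then have "real (2 * m k + 1 + Q k * (8 * k + 8)) \<le> e * real (2 ^ m k)"
        using short[of k] by simp
      then show "\<exists>l n. l \<ge> 1 \<and> word_in ?G S n (f [^]\<^bsub>?G\<^esub> (l::nat)) \<and> real n \<le> e * real l"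
        using word[of k] by (intro exI[of _ "2 ^ m k"] exI[of _ "2 * m k + 1 + Q k * (8 * k + 8)"]) simp
    qed (auto simp: S_def)
    then show ?thesis by (simp add: Homeo0_annulus_def)
  qed
  ultimately show ?thesis by blast
qed

end
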